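(* Let $A$ be a $C^*$-algebra, $J\subset A$ an essential ideal, and $M$ a Hilbert $C^*$-module over $A$. Let $\underline{\alpha}:\mathbb B_J(M)\to\mathbb B^*(M_J)$ be the map $T\mapsto\underline T=T|_{M_J}$, and let $\alpha:\mathbb B^*(M^J)\to\mathbb B^*(M_J)$ be the restriction map $R\mapsto R|_{M_J}$. Then $\alpha$ and $\underline{\alpha}$ are isometric injective homomorphisms.
   Context: Ideals are closed two-sided; $J$ essential means $aJ=0\Rightarrow a=0$ for $a\in A$. Inner products are $A$-linear in the second variable. $\mathbb B(M)$ is the Banach algebra of bounded $A$-linear maps $M\to M$ (operator norm), and $\mathbb B^*(L)$ is the $C^*$-algebra of adjointable operators on a Hilbert $C^*$-module $L$ (operators $R$ admitting $R^*$ with $\langle R^*k,l\rangle=\langle k,Rl\rangle$). $M'$ is the set of bounded linear maps $f:M\to A$ with $f(ma)=a^*f(m)$, a right $A$-module via $(fa)(m)=f(m)a$; $M$ is identified with $\widehat M\subset M'$ via $\widehat m(n)=\langle n,m\rangle$. For $T\in\mathbb B(M)$, $T^*:M'\to M'$ is $T^*(f)(m)=f(Tm)$; $T$ is $J$-adjointable if $T^*(\widehat n)x\in\widehat M$ for all $n\in M$, $x\in J$. $\mathbb B_J(M)$ is the Banach algebra of $J$-adjointable operators on $M$. $M_J$ is the norm closure of the finite sums $\sum_i m_ix_i$, $m_i\in M$, $x_i\in J$; every $T\in\mathbb B(M)$ maps $M_J$ into itself, and for $T\in\mathbb B_J(M)$ the restriction $T|_{M_J}$ is adjointable. $M_1(J)=\{f\in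 M': fx\in M\ \forall x\in J\}$. For $f,g\in M_1(J)$, $\langle g,f\rangle\in M(J)$ (multiplier algebra of $J$) is the double multiplier $(\lambda,\rho)$ with $\lambda(x)=(g(fx))^*$, $\rho(x)=f(gx^* )$, $x\in J$ ($fx,gx^*$ regarded as elements of $M$). $A$ is identified with its image under the injective map $A\to M(J)$. $M^J=\{f\in M_1(J):\langle g,f\rangle\in A\ \forall g\in M_1(J)\}$, a Hilbert $C^*$-module over $A$ containing $M$, with $(M^J)_J=M_J$, so each $R\in\mathbb B^*(M^J)$ restricts to an adjointable operator on $M_J$. *)

theory Defs
  imports "HOL-Analysis.Analysis"
begin

class cstar_algebra = banach + real_normed_algebra +
  fixes scaleC :: "complex \<Rightarrow> 'a \<Rightarrow> 'a"
    and cstar :: "'a \<Rightarrow> 'a"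
  assumes cs_scaleC_add_right: "scaleC c (x + y) = scaleC c x + scaleC c y"
    and cs_scaleC_add_left: "scaleC (c + d) x = scaleC c x + scaleC d x"
    and cs_scaleC_scaleC: "scaleC c (scaleC d x) = scaleC (c * d) x"
    and cs_scaleC_one: "scaleC 1 x = x"
    and cs_scaleR_scaleC: "scaleR r x = scaleC (complex_of_real r) x"
    and cs_norm_scaleC: "norm (scaleC c x) = cmod c * norm x"
    and cs_mult_scaleC_left: "scaleC c x * y = scaleC c (x * y)"
    and cs_mult_scaleC_right: "x * scaleC c y = scaleC c (x * y)"
    and cs_cstar_add: "cstar (x + y) = cstar x + cstar y"
    and cs_cstar_scaleC: "cstar (scaleC c x) = scaleC (cnj c) (cstar x)"
    and cs_cstar_mult: "cstar (x * y) = cstar y * cstar x"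
    and cs_cstar_cstar: "cstar (cstar x) = x"
    and cs_cstar_identity: "norm (cstar x * x) = (norm x)\<^sup>2"

definition cs_positive :: "'a::cstar_algebra \<Rightarrow> bool" where
  "cs_positive a \<longleftrightarrow> (\<exists>b. a = cstar b * b)"

definition cstar_ideal :: "'a::cstar_algebra set \<Rightarrow> bool" where
  "cstar_ideal J \<longleftrightarrow> closed J \<and> 0 \<in> J \<and>
     (\<forall>x\<in>J. \<forall>y\<in>J. x + y \<in> J) \<and> (\<forall>c. \<forall>x\<in>J. scaleC c x \<in> J) \<and>
     (\<forall>a. \<forall>x\<in>J. a * x \<in> J \<and> x * a \<in> J)"

definition essential_ideal :: "'a::cstar_algebra set \<Rightarrow> bool" where
  "essential_ideal J \<longleftrightarrow> (\<forall>a. (\<forall>x\<in>J. a * x = 0) \<longrightarrow> a = 0)"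

record ('m, 'a) hmod =
  hcarrier :: "'m set"
  hadd :: "'m \<Rightarrow> 'm \<Rightarrow> 'm"
  hzero :: "'m"
  hscale :: "complex \<Rightarrow> 'm \<Rightarrow> 'm"
  hact :: "'m \<Rightarrow> 'a \<Rightarrow> 'm"
  hip :: "'m \<Rightarrow> 'm \<Rightarrow> 'a"

definition hnorm :: "('m, 'a::cstar_algebra, 'b) hmod_scheme \<Rightarrow> 'm \<Rightarrow> real" where
  "hnorm L m = sqrt (norm (hip L m m))"

definition hdist :: "('m, 'a::cstar_algebra, 'b) hmod_scheme \<Rightarrow> 'm \<Rightarrow> 'm \<Rightarrow> real" where
  "hdist L m n = hnorm L (hadd L m (hscale L (-1) n))"

definition hilbert_module :: "('m, 'a::cstar_algebra, 'b) hmod_scheme \<Rightarrow> bool" where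
  "hilbert_module L \<longleftrightarrow> (let C = hcarrier L in
     hzero L \<in> C \<and>
     (\<forall>m\<in>C. \<forall>n\<in>C. hadd L m n \<in> C) \<and>
     (\<forall>c. \<forall>m\<in>C. hscale L c m \<in> C) \<and>
     (\<forall>a. \<forall>m\<in>C. hact L m a \<in> C) \<and>
     (\<forall>m\<in>C. \<forall>n\<in>C. \<forall>k\<in>C. hadd L (hadd L m n) k = hadd L m (hadd L n k)) \<and>
     (\<forall>m\<in>C. \<forall>n\<in>C. hadd L m n = hadd L n m) \<and>
     (\<forall>m\<in>C. hadd L (hzero L) m = m) \<and>
     (\<forall>m\<in>C. hadd L m (hscale L (-1) m) = hzero L) \<and>
     (\<forall>c. \<forall>m\<in>C. \<forall>n\<in>C. hscale L c (hadd L m n) = hadd L (hscale L c m) (hscale L c n)) \<and>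
     (\<forall>c d. \<forall>m\<in>C. hscale L (c + d) m = hadd L (hscale L c m) (hscale L d m)) \<and>
     (\<forall>c d. \<forall>m\<in>C. hscale L c (hscale L d m) = hscale L (c * d) m) \<and>
     (\<forall>m\<in>C. hscale L 1 m = m) \<and>
     (\<forall>a b. \<forall>m\<in>C. hact L (hact L m a) b = hact L m (a * b)) \<and>
     (\<forall>a. \<forall>m\<in>C. \<forall>n\<in>C. hact L (hadd L m n) a = hadd L (hact L m a) (hact L n a)) \<and>
     (\<forall>a b. \<forall>m\<in>C. hact L m (a + b) = hadd L (hact L m a) (hact L m b)) \<and>
     (\<forall>a c. \<forall>m\<in>C. hact L (hscale L c m) a = hscale L c (hact L m a)) \<and>
     (\<forall>a c. \<forall>m\<in>C. hact L m (scaleC c a) = hscale L c (hact L m a)) \<and>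
     (\<forall>m\<in>C. \<forall>n\<in>C. \<forall>k\<in>C. hip L m (hadd L n k) = hip L m n + hip L m k) \<and>
     (\<forall>c. \<forall>m\<in>C. \<forall>n\<in>C. hip L m (hscale L c n) = scaleC c (hip L m n)) \<and>
     (\<forall>a. \<forall>m\<in>C. \<forall>n\<in>C. hip L m (hact L n a) = hip L m n * a) \<and>
     (\<forall>m\<in>C. \<forall>n\<in>C. cstar (hip L m n) = hip L n m) \<and>
     (\<forall>m\<in>C. cs_positive (hip L m m)) \<and>
     (\<forall>m\<in>C. hip L m m = 0 \<longrightarrow> m = hzero L) \<and>
     (\<forall>s. (\<forall>k. s k \<in> C) \<and> (\<forall>e>0. \<exists>N. \<forall>p\<ge>N. \<forall>q\<ge>N. hdist L (s p) (s q) < e)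
          \<longrightarrow> (\<exists>m\<in>C. (\<lambda>k. hdist L (s k) m) \<longlonglongrightarrow> 0)))"

definition bounded_Alin :: "('m, 'a::cstar_algebra, 'b) hmod_scheme \<Rightarrow> ('m \<Rightarrow> 'm) set" where
  "bounded_Alin L = {T. (\<forall>m\<in>hcarrier L. T m \<in> hcarrier L) \<and>
     (\<forall>m\<in>hcarrier L. \<forall>n\<in>hcarrier L. T (hadd L m n) = hadd L (T m) (T n)) \<and>
     (\<forall>c. \<forall>m\<in>hcarrier L. T (hscale L c m) = hscale L c (T m)) \<and>
     (\<forall>a. \<forall>m\<in>hcarrier L. T (hact L m a) = hact L (T m) a) \<and>
     (\<exists>K. \<forall>m\<in>hcarrier L. hnorm L (T m) \<le> K * hnorm L m)}"

definition adjointable :: "('m, 'a::cstar_algebra, 'b) hmod_scheme \<Rightarrow> ('m \<Rightarrow> 'm) set" where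
  "adjointable L = {R. (\<forall>m\<in>hcarrier L. R m \<in> hcarrier L) \<and>
     (\<exists>Rs. (\<forall>m\<in>hcarrier L. Rs m \<in> hcarrier L) \<and>
           (\<forall>k\<in>hcarrier L. \<forall>l\<in>hcarrier L. hip L (Rs k) l = hip L k (R l)))}"

definition opnorm :: "('m, 'a::cstar_algebra, 'b) hmod_scheme \<Rightarrow> ('m \<Rightarrow> 'm) \<Rightarrow> real" where
  "opnorm L T = Sup ((\<lambda>m. hnorm L (T m)) ` {m \<in> hcarrier L. hnorm L m \<le> 1})"

definition op_add :: "('m, 'a, 'b) hmod_scheme \<Rightarrow> ('m \<Rightarrow> 'm) \<Rightarrow> ('m \<Rightarrow> 'm) \<Rightarrow> 'm \<Rightarrow> 'm" where
  "op_add L S T = (\<lambda>x. hadd L (S x) (T x))"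

definition op_scale :: "('m, 'a, 'b) hmod_scheme \<Rightarrow> complex \<Rightarrow> ('m \<Rightarrow> 'm) \<Rightarrow> 'm \<Rightarrow> 'm" where
  "op_scale L c T = (\<lambda>x. hscale L c (T x))"

text \<open>Equality of operators (they are only relevant on the carrier).\<close>

definition eq_on_carrier :: "('m, 'a, 'b) hmod_scheme \<Rightarrow> ('m \<Rightarrow> 'm) \<Rightarrow> ('m \<Rightarrow> 'm) \<Rightarrow> bool" where
  "eq_on_carrier L S T \<longleftrightarrow> (\<forall>x\<in>hcarrier L. S x = T x)"

definition mhat :: "('m, 'a::cstar_algebra, 'b) hmod_scheme \<Rightarrow> 'm \<Rightarrow> 'm \<Rightarrow> 'a" where
  "mhat M n = (\<lambda>m. if m \<in> hcarrier M then hip M m n else 0)"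

definition Mprime :: "('m, 'a::cstar_algebra, 'b) hmod_scheme \<Rightarrow> ('m \<Rightarrow> 'a) set" where
  "Mprime M = {f. (\<forall>m. m \<notin> hcarrier M \<longrightarrow> f m = 0) \<and>
     (\<forall>m\<in>hcarrier M. \<forall>n\<in>hcarrier M. f (hadd M m n) = f m + f n) \<and>
     (\<forall>a. \<forall>m\<in>hcarrier M. f (hact M m a) = cstar a * f m) \<and>
     (\<exists>K. \<forall>m\<in>hcarrier M. norm (f m) \<le> K * hnorm M m)}"

definition fact :: "('m \<Rightarrow> 'a::cstar_algebra) \<Rightarrow> 'a \<Rightarrow> 'm \<Rightarrow> 'a" where
  "fact f a = (\<lambda>m. f m * a)"

definition elem :: "('m, 'a::cstar_algebra, 'b) hmod_scheme \<Rightarrow> ('m \<Rightarrow> 'a) \<Rightarrow> 'm" where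
  "elem M f = (THE n. n \<in> hcarrier M \<and> mhat M n = f)"

definition M1 :: "('m, 'a::cstar_algebra, 'b) hmod_scheme \<Rightarrow> 'a set \<Rightarrow> ('m \<Rightarrow> 'a) set" where
  "M1 M J = {f \<in> Mprime M. \<forall>x\<in>J. fact f x \<in> mhat M ` hcarrier M}"

text \<open>a represents the double multiplier \<open>\<langle>g,f\<rangle> = (\<lambda>,\<rho>)\<close> of J.\<close>

definition is_mult_ip :: "('m, 'a::cstar_algebra, 'b) hmod_scheme \<Rightarrow> 'a set \<Rightarrow>
    ('m \<Rightarrow> 'a) \<Rightarrow> ('m \<Rightarrow> 'a) \<Rightarrow> 'a \<Rightarrow> bool" where
  "is_mult_ip M J g f a \<longleftrightarrow>
     (\<forall>x\<in>J. a * x = cstar (g (elem M (fact f x))) \<and> x * a = f (elem M (fact g (cstar x))))"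

definition MupJ :: "('m, 'a::cstar_algebra, 'b) hmod_scheme \<Rightarrow> 'a set \<Rightarrow> ('m \<Rightarrow> 'a) set" where
  "MupJ M J = {f \<in> M1 M J. \<forall>g\<in>M1 M J. \<exists>a. is_mult_ip M J g f a}"

definition mjip :: "('m, 'a::cstar_algebra, 'b) hmod_scheme \<Rightarrow> 'a set \<Rightarrow>
    ('m \<Rightarrow> 'a) \<Rightarrow> ('m \<Rightarrow> 'a) \<Rightarrow> 'a" where
  "mjip M J g f = (THE a. is_mult_ip M J g f a)"

definition MupJ_mod :: "('m, 'a::cstar_algebra, 'b) hmod_scheme \<Rightarrow> 'a set \<Rightarrow> ('m \<Rightarrow> 'a, 'a) hmod" where
  "MupJ_mod M J = \<lparr>hcarrier = MupJ M J, hadd = (\<lambda>f g m. f m + g m), hzero = (\<lambda>m. 0),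
     hscale = (\<lambda>c f m. scaleC c (f m)), hact = (\<lambda>f a m. f m * a), hip = mjip M J\<rparr>"

inductive_set MJalg :: "('m, 'a::cstar_algebra, 'b) hmod_scheme \<Rightarrow> 'a set \<Rightarrow> 'm set"
  for M J where
    MJ_zero: "hzero M \<in> MJalg M J"
  | MJ_gen: "m \<in> hcarrier M \<Longrightarrow> x \<in> J \<Longrightarrow> hact M m x \<in> MJalg M J"
  | MJ_add: "u \<in> MJalg M J \<Longrightarrow> v \<in> MJalg M J \<Longrightarrow> hadd M u v \<in> MJalg M J"

definition MsubJ :: "('m, 'a::cstar_algebra, 'b) hmod_scheme \<Rightarrow> 'a set \<Rightarrow> 'm set" where
  "MsubJ M J = {m \<in> hcarrier M. \<forall>e>0. \<exists>u\<in>MJalg M J. hdist M m u < e}"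

definition MsubJ_mod :: "('m, 'a::cstar_algebra, 'b) hmod_scheme \<Rightarrow> 'a set \<Rightarrow> ('m, 'a, 'b) hmod_scheme" where
  "MsubJ_mod M J = M\<lparr>hcarrier := MsubJ M J\<rparr>"

definition Tstar :: "('m, 'a::cstar_algebra, 'b) hmod_scheme \<Rightarrow> ('m \<Rightarrow> 'm) \<Rightarrow> ('m \<Rightarrow> 'a) \<Rightarrow> 'm \<Rightarrow> 'a" where
  "Tstar M T f = (\<lambda>m. if m \<in> hcarrier M then f (T m) else 0)"

definition BJ :: "('m, 'a::cstar_algebra, 'b) hmod_scheme \<Rightarrow> 'a set \<Rightarrow> ('m \<Rightarrow> 'm) set" where
  "BJ M J = {T \<in> bounded_Alin M. \<forall>n\<in>hcarrier M. \<forall>x\<in>J.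
              fact (Tstar M T (mhat M n)) x \<in> mhat M ` hcarrier M}"

text \<open>\<open>\<alpha>(R) = R|_{M_J}\<close>, using the identification of M with \<open>\<widehat>M \<subseteq> M^J\<close>.\<close>

definition alpha :: "('m, 'a::cstar_algebra, 'b) hmod_scheme \<Rightarrow> 'a set \<Rightarrow>
    (('m \<Rightarrow> 'a) \<Rightarrow> ('m \<Rightarrow> 'a)) \<Rightarrow> 'm \<Rightarrow> 'm" where
  "alpha M J R = (\<lambda>m. if m \<in> MsubJ M J then elem M (R (mhat M m)) else hzero M)"

definition ualpha :: "('m, 'a::cstar_algebra, 'b) hmod_scheme \<Rightarrow> 'a set \<Rightarrow> ('m \<Rightarrow> 'm) \<Rightarrow> 'm \<Rightarrow> 'm" where
  "ualpha M J T = (\<lambda>m. if m \<in> MsubJ M J then T m else hzero M)"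

definition isometric_injective_hom ::
  "('m, 'a::cstar_algebra, 'b) hmod_scheme \<Rightarrow> ('n, 'a, 'c) hmod_scheme \<Rightarrow>
   ('m \<Rightarrow> 'm) set \<Rightarrow> (('m \<Rightarrow> 'm) \<Rightarrow> ('n \<Rightarrow> 'n)) \<Rightarrow> bool" where
  "isometric_injective_hom L1 L2 D \<phi> \<longleftrightarrow>
     (\<forall>R\<in>D. \<phi> R \<in> adjointable L2) \<and>
     (\<forall>R\<in>D. \<forall>S\<in>D. eq_on_carrier L2 (\<phi> (op_add L1 R S)) (op_add L2 (\<phi> R) (\<phi> S))) \<and>
     (\<forall>c. \<forall>R\<in>D. eq_on_carrier L2 (\<phi> (op_scale L1 c R)) (op_scale L2 c (\<phi> R))) \<and>
     (\<forall>R\<in>D. \<forall>S\<in>D. eq_on_carrier L2 (\<phi> (R \<circ> S)) (\<phi> R \<circ> \<phi> S)) \<and>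
     (\<forall>R\<in>D. opnorm L2 (\<phi> R) = opnorm L1 R) \<and>
     (\<forall>R\<in>D. \<forall>S\<in>D. eq_on_carrier L2 (\<phi> R) (\<phi> S) \<longrightarrow> eq_on_carrier L1 R S)"

end

theory Submission
  imports Defs
begin

text \<open>
  Everything reduces to two facts about an essential ideal \<open>J\<close> of \<open>A\<close>: left multiplication of \<open>A\<close> on
  \<open>J\<close> is isometric, and a self-adjoint \<open>a\<close> with \<open>x\<^sup>*ax \<ge> 0\<close> for all \<open>x \<in> J\<close> is positive.  Since an
  \<open>A\<close>-linear operator \<open>T\<close> satisfies \<open>T(m)x = T(mx)\<close> with \<open>mx \<in> M\<^sub>J\<close>, the first fact makes
  \<open>T \<mapsto> T|M\<^sub>J\<close> isometric and injective; the second makes \<open>\<langle>f,f\<rangle>\<close> positive for \<open>f \<in> M\<^sup>J\<close>, so that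
  the same argument works in \<open>M\<^sup>J\<close>.

  \<open>M\<^sub>J\<close> consists of the \<open>m\<close> with \<open>\<langle>m,m\<rangle> \<in> J\<close>, and for \<open>h = \<langle>m,m\<rangle>\<close> of norm at most \<open>1\<close> the elements
  \<open>e\<^sub>k = 1 - (1 - h)\<^sup>k \<in> J\<close> satisfy \<open>m e\<^sub>k \<longrightarrow> m\<close>.  This yields the adjoint of \<open>T|M\<^sub>J\<close> as a limit, and
  it shows \<open>R(m) \<in> M\<^sub>J\<close> for \<open>R\<close> adjointable on \<open>M\<^sup>J\<close> and \<open>m \<in> M\<^sub>J\<close>, because
  \<open>\<langle>R m, R m\<rangle> = \<langle>R\<^sup>*R m, m\<rangle> \<in> J\<close>.

  Positivity is handled without spectral theory: \<open>a = a\<^sup>*\<close> is positive if \<open>\<parallel>t - a\<parallel> \<le> t\<close> for some \<open>t\<close>, which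
  describes a cone and, by the iteration \<open>y \<mapsto> (x + y\<^sup>2)/2\<close> for \<open>1 - \<surd>(1 - x)\<close>, exactly the squares of
  self-adjoint elements.
\<close>

subsection \<open>Positivity in unital \<open>C\<^sup>*\<close>-algebras\<close>

class cstar_algebra_1 = cstar_algebra + real_normed_algebra_1

lemma cstar_zero [simp]: "cstar (0::'a::cstar_algebra) = 0"
  using cs_cstar_add[of 0 "0::'a"] by simp

lemma cstar_minus: "cstar (- x) = - cstar (x::'a::cstar_algebra)"
  using cs_cstar_add[of x "-x"] by (simp add: eq_neg_iff_add_eq_0 add.commute)

lemma cstar_diff: "cstar (x - y) = cstar x - cstar (y::'a::cstar_algebra)"
  using cs_cstar_add[of x "-y"] by (simp add: cstar_minus)

lemma cstar_scaleR: "cstar (r *\<^sub>R x) = r *\<^sub>R cstar (x::'a::cstar_algebra)"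
  by (simp add: cs_scaleR_scaleC cs_cstar_scaleC)

lemma scaleC_minus_left: "scaleC (- c) x = - scaleC c (x::'a::cstar_algebra)"
proof -
  have "scaleC (-c) x + scaleC c x = scaleC 0 x" by (simp flip: cs_scaleC_add_left)
  also have "\<dots> = 0" using cs_scaleR_scaleC[of 0 x] by simp
  finally show ?thesis by (simp add: eq_neg_iff_add_eq_0)
qed

lemma scaleC_zero_right [simp]: "scaleC c (0::'a::cstar_algebra) = 0"
  using cs_scaleC_add_right[of c 0 "0::'a"] by simp

lemma scaleC_minus_right: "scaleC c (- x) = - scaleC c (x::'a::cstar_algebra)"
  using cs_scaleC_add_right[of c x "-x"] by (simp add: eq_neg_iff_add_eq_0 add.commute)

lemma scaleC_diff_right: "scaleC c (x - y) = scaleC c x - scaleC c (y::'a::cstar_algebra)"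
  using cs_scaleC_add_right[of c x "-y"] by (simp add: scaleC_minus_right)

lemma norm_cstar [simp]: "norm (cstar x) = norm (x::'a::cstar_algebra)"
proof -
  have le: "norm y \<le> norm (cstar y)" for y :: 'a
  proof (cases "y = 0")
    case False
    have "norm y * norm y \<le> norm (cstar y) * norm y"
      using norm_mult_ineq[of "cstar y" y] by (simp add: cs_cstar_identity power2_eq_square)
    then show ?thesis using False by simp
  qed simp
  show ?thesis using le[of x] le[of "cstar x"] by (simp add: cs_cstar_cstar)
qed

lemma norm_mult_cstar: "norm (x * cstar x) = (norm (x::'a::cstar_algebra))\<^sup>2"
  using cs_cstar_identity[of "cstar x"] by (simp add: cs_cstar_cstar)

lemma norm_square_selfadj:
  "cstar x = x \<Longrightarrow> norm (x * x) = (norm (x::'a::cstar_algebra))\<^sup>2"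
  by (metis cs_cstar_identity)

lemma bounded_linear_cstar: "bounded_linear (cstar :: 'a \<Rightarrow> 'a::cstar_algebra)"
  by (rule bounded_linear_intro[where K = 1]) (simp_all add: cs_cstar_add cstar_scaleR)

lemmas tendsto_cstar = bounded_linear.tendsto[OF bounded_linear_cstar]

lemma cstar_one [simp]: "cstar (1::'a::cstar_algebra_1) = 1"
  by (metis cs_cstar_cstar cs_cstar_mult mult_1)

lemma cstar_power: "cstar (x ^ n) = cstar (x::'a::cstar_algebra_1) ^ n"
  by (induction n) (simp_all add: cs_cstar_mult power_commutes)

section \<open>Square roots and the cone of positive elements\<close>

lemma sqrt_one_minus:
  fixes x :: "'a::cstar_algebra_1"
  assumes nx: "norm x \<le> 1" and sx: "cstar x = x"
  obtains w where "cstar w = w" "w * w = 1 - x" "norm (1 - w) \<le> 1"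
    "\<And>z. z * x = x * z \<Longrightarrow> z * w = w * z"
proof -
  \<comment> \<open>A limit of \<open>y\<close> solves 2y = x + y^2, that is, (1 - y)^2 = 1 - x. The
    real sequence \<open>r\<close> is the same iteration for x = 1; it increases, stays below 1, and
    majorises both \<open>y\<close> and its increments.\<close>
  define y where "y = rec_nat (0::'a) (\<lambda>_ v. (1/2) *\<^sub>R (x + v * v))"
  define r where "r = rec_nat (0::real) (\<lambda>_ v. (1/2) * (1 + v * v))"
  have y0: "y 0 = 0" and yS: "y (Suc n) = (1/2) *\<^sub>R (x + y n * y n)" for n
    by (simp_all add: y_def)
  have r0: "r 0 = 0" and rS: "r (Suc n) = (1/2) * (1 + r n * r n)" for n
    by (simp_all add: r_def)
  have rb: "0 \<le> r n \<and> r n \<le> 1" for n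
  proof (induction n)
    case (Suc n)
    then have "r n * r n \<le> 1 * 1" by (intro mult_mono) auto
    then show ?case by (simp add: rS)
  qed (simp add: r0)
  have ny: "norm (y n) \<le> r n" for n
  proof (induction n)
    case (Suc n)
    have "norm (y n * y n) \<le> r n * r n"
      using norm_mult_ineq[of "y n" "y n"] mult_mono[OF Suc Suc] rb[of n] by force
    then have "norm (x + y n * y n) \<le> 1 + r n * r n"
      using nx norm_triangle_ineq[of x "y n * y n"] by linarith
    then show ?case by (simp add: yS rS)
  qed (simp add: y0 r0)
  have dy: "norm (y (Suc n) - y n) \<le> r (Suc n) - r n" for n
  proof (induction n)
    case (Suc n)
    let ?a = "y (Suc n)" and ?b = "y n"
    have "(1/2) *\<^sub>R (x + a * a) - (1/2) *\<^sub>R (x + b * b) = (1/2) *\<^sub>R (a * (a - b) + (a - b) * b)" for a b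
      by (simp add: algebra_simps)
    from this[of ?a ?b]
    have e: "y (Suc (Suc n)) - y (Suc n) = (1/2) *\<^sub>R (?a * (?a - ?b) + (?a - ?b) * ?b)"
      by (simp only: yS[symmetric])
    have "norm (?a * (?a - ?b) + (?a - ?b) * ?b) \<le> norm ?a * norm (?a - ?b) + norm (?a - ?b) * norm ?b"
      by (intro norm_triangle_le add_mono norm_mult_ineq)
    also have "\<dots> \<le> r (Suc n) * (r (Suc n) - r n) + (r (Suc n) - r n) * r n"
      using Suc rb order_trans[OF norm_ge_zero Suc] by (intro add_mono mult_mono ny) auto
    also have "\<dots> = 2 * (r (Suc (Suc n)) - r (Suc n))"
    proof -
      have "a * (a - b) + (a - b) * b = 2 * ((1/2) * (1 + a * a) - (1/2) * (1 + b * b))" for a b :: real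
        by (simp add: algebra_simps)
      from this[of "r (Suc n)" "r n"] show ?thesis by (simp only: rS[symmetric])
    qed
    finally show ?case unfolding e by simp
  next
    case 0
    then show ?case using nx by (simp add: y0 r0 yS rS)
  qed
  have inc: "r n \<le> r (Suc n)" for n using order_trans[OF norm_ge_zero dy[of n]] by simp
  then have "incseq r" by (rule incseq_SucI)
  then obtain L where "r \<longlonglongrightarrow> L" using incseq_convergent[of r 1] rb by blast
  then have cr: "Cauchy r" by (rule LIMSEQ_imp_Cauchy)
  have dk: "norm (y (m + k) - y m) \<le> r (m + k) - r m" for m k
  proof (induction k)
    case (Suc k)
    have "norm (y (m + Suc k) - y m) \<le> norm (y (Suc (m + k)) - y (m + k)) + norm (y (m + k) - y m)"
      using norm_triangle_ineq[of "y (Suc (m + k)) - y (m + k)" "y (m + k) - y m"] by simp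
    also have "\<dots> \<le> r (m + Suc k) - r m" using Suc dy[of "m + k"] by simp
    finally show ?case .
  qed simp
  have "Cauchy y"
  proof (rule CauchyI')
    fix e :: real assume "0 < e"
    then obtain N where N: "\<And>m n. m \<ge> N \<Longrightarrow> n \<ge> N \<Longrightarrow> norm (r m - r n) < e"
      using CauchyD[OF cr] by meson
    show "\<exists>N. \<forall>m\<ge>N. \<forall>n>m. dist (y m) (y n) < e"
    proof (intro exI allI impI)
      fix m n assume mn: "N \<le> m" "m < n"
      have "norm (y n - y m) \<le> r n - r m" using dk[of m "n - m"] mn by simp
      also have "\<dots> < e" using N[of n m] mn by simp
      finally show "dist (y m) (y n) < e" by (simp add: dist_norm norm_minus_commute)
    qed
  qed
  then obtain l where l: "y \<longlonglongrightarrow> l" by (auto simp: Cauchy_convergent_iff convergent_def)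
  have "(\<lambda>n. y (Suc n)) \<longlonglongrightarrow> (1/2) *\<^sub>R (x + l * l)"
    unfolding yS by (intro tendsto_intros l)
  then have eq: "l = (1/2) *\<^sub>R (x + l * l)" using LIMSEQ_Suc[OF l] LIMSEQ_unique by blast
  have sy: "cstar (y n) = y n" for n
    by (induction n) (simp_all add: y0 yS cstar_scaleR cs_cstar_add cs_cstar_mult sx)
  have sl: "cstar l = l" using tendsto_cstar[OF l] l unfolding sy by (rule LIMSEQ_unique)
  \<comment> \<open>Every iterate is a polynomial in \<open>x\<close>, so whatever commutes with
    \<open>x\<close> commutes with the root. This is how roots of commuting elements can be chosen
    commuting later.\<close>
  have cy: "z * y n = y n * z" if z: "z * x = x * z" for z n
  proof (induction n)
    case (Suc n)
    have "z * (y n * y n) = (y n * z) * y n" by (simp only: mult.assoc[symmetric] Suc)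
    also have "\<dots> = (y n * y n) * z" by (simp only: mult.assoc Suc)
    finally have "z * (x + y n * y n) = (x + y n * y n) * z" using z by (simp add: distrib_left distrib_right)
    then show ?case by (simp add: yS)
  qed (simp add: y0)
  have cl: "z * l = l * z" if z: "z * x = x * z" for z
  proof -
    have "(\<lambda>n. z * y n) \<longlonglongrightarrow> z * l" "(\<lambda>n. y n * z) \<longlonglongrightarrow> l * z" by (intro tendsto_intros l)+
    then show ?thesis unfolding cy[OF z] by (rule LIMSEQ_unique)
  qed
  have nl: "norm l \<le> 1"
  proof (rule LIMSEQ_le_const2[OF tendsto_norm[OF l]])
    show "\<exists>N. \<forall>n\<ge>N. norm (y n) \<le> 1" using ny rb by (meson order_trans)
  qed
  have "2 *\<^sub>R l = 2 *\<^sub>R ((1/2) *\<^sub>R (x + l * l))" using eq by (rule arg_cong)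
  then have "2 *\<^sub>R l = x + l * l" by simp
  then have sq: "(1 - l) * (1 - l) = 1 - x" by (simp add: algebra_simps scaleR_2)
  have comm: "z * (1 - l) = (1 - l) * z" if "z * x = x * z" for z
    using cl[OF that] by (simp add: algebra_simps)
  show ?thesis
  proof (rule that)
    show "cstar (1 - l) = 1 - l" "norm (1 - (1 - l)) \<le> 1" using sl nl by (simp_all add: cstar_diff)
  qed (fact sq comm)+
qed

text \<open>For self-adjoint \<open>a\<close> the inequality places the spectrum in [0, 2t]; t \<ge>
  0 is automatic, since t bounds a norm.\<close>

definition cpos :: "'a::cstar_algebra_1 \<Rightarrow> bool" where
  "cpos a \<longleftrightarrow> cstar a = a \<and> (\<exists>t. norm (t *\<^sub>R 1 - a) \<le> t)"

lemma cpos_selfadj: "cpos a \<Longrightarrow> cstar a = a" by (simp add: cpos_def)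

lemma cpos_add: "cpos a \<Longrightarrow> cpos b \<Longrightarrow> cpos (a + b)"
proof -
  assume "cpos a" "cpos b"
  then obtain s t where "cstar a = a" "cstar b = b" "norm (s *\<^sub>R 1 - a) \<le> s" "norm (t *\<^sub>R 1 - b) \<le> t"
    unfolding cpos_def by blast
  moreover have "norm ((s + t) *\<^sub>R 1 - (a + b)) \<le> norm (s *\<^sub>R 1 - a) + norm (t *\<^sub>R 1 - b)"
    using norm_triangle_ineq[of "s *\<^sub>R 1 - a" "t *\<^sub>R 1 - b"] by (simp add: algebra_simps)
  ultimately show ?thesis unfolding cpos_def by (intro conjI exI[of _ "s + t"]) (auto simp: cs_cstar_add)
qed

lemma cpos_scaleR: "cpos a \<Longrightarrow> 0 \<le> r \<Longrightarrow> cpos (r *\<^sub>R a)"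
proof -
  assume "cpos a" "0 \<le> r"
  then obtain t where t: "cstar a = a" "norm (t *\<^sub>R 1 - a) \<le> t" unfolding cpos_def by blast
  have "(r * t) *\<^sub>R 1 - r *\<^sub>R a = r *\<^sub>R (t *\<^sub>R 1 - a)" by (simp add: algebra_simps)
  then have "norm ((r * t) *\<^sub>R 1 - r *\<^sub>R a) \<le> r * t"
    using t \<open>0 \<le> r\<close> by (simp add: mult_left_mono)
  then show ?thesis unfolding cpos_def using t(1) by (auto simp: cstar_scaleR)
qed

lemma cpos_norm_diff: "cstar a = a \<Longrightarrow> norm a \<le> r \<Longrightarrow> cpos (r *\<^sub>R 1 - a)"
  unfolding cpos_def by (auto simp: cstar_diff cstar_scaleR intro!: exI[of _ r])

text \<open>After division by t, \<open>x = 1 - a/t\<close> has norm at most 1. The root of 1 - x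
  has distance at most 1 from the unit, so it is positive with witness 1.\<close>

lemma cpos_sqrt:
  assumes "cpos a"
  obtains w where "cpos w" "w * w = a" "\<And>z. z * a = a * z \<Longrightarrow> z * w = w * z"
proof -
  obtain t where t: "cstar a = a" "norm (t *\<^sub>R 1 - a) \<le> t" using assms unfolding cpos_def by blast
  then have t0: "0 \<le> t" using norm_ge_zero order_trans by blast
  show ?thesis
  proof (cases "t = 0")
    case True
    then show ?thesis using t that[of 0] by (auto simp: cpos_def)
  next
    case False
    define x where "x = 1 - (1/t) *\<^sub>R a"
    have "x = (1/t) *\<^sub>R (t *\<^sub>R 1 - a)" using False by (simp add: x_def algebra_simps)
    then have "norm x \<le> 1" using t t0 False by (simp add: divide_simps)
    moreover have "cstar x = x" by (simp add: x_def cstar_diff cstar_scaleR t)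
    ultimately obtain w where w: "cstar w = w" "w * w = 1 - x" "norm (1 - w) \<le> 1"
      "\<And>z. z * x = x * z \<Longrightarrow> z * w = w * z" using sqrt_one_minus by blast
    have cw: "cpos w" unfolding cpos_def using w(1,3) by (auto intro!: exI[of _ 1])
    have sq: "(sqrt t *\<^sub>R w) * (sqrt t *\<^sub>R w) = a"
      using w(2) t0 False by (simp add: x_def)
    have comm: "z * (sqrt t *\<^sub>R w) = (sqrt t *\<^sub>R w) * z" if "z * a = a * z" for z
      using w(4)[of z] that by (simp add: x_def algebra_simps)
    show ?thesis by (rule that[OF cpos_scaleR[OF cw] sq comm]) (use t0 in simp)
  qed
qed

text \<open>The element \<open>u = c + i d\<close> satisfies \<open>cstar u * u = 1\<close>, hence
  has norm 1, and \<open>c\<close> is its real part.\<close>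

lemma norm_le_one_of_squares:
  fixes c d :: "'a::cstar_algebra_1"
  assumes "cstar c = c" "cstar d = d" "c * d = d * c" "c * c + d * d = 1"
  shows "norm c \<le> 1"
proof -
  define u where "u = c + scaleC \<i> d"
  have su: "cstar u = c - scaleC \<i> d"
    by (simp add: u_def cs_cstar_add cs_cstar_scaleC assms scaleC_minus_left)
  have "scaleC \<i> d * scaleC \<i> d = - (d * d)"
    by (simp add: cs_mult_scaleC_left cs_mult_scaleC_right cs_scaleC_scaleC scaleC_minus_left cs_scaleC_one)
  then have "cstar u * u = 1"
    unfolding su unfolding u_def
    using assms(3,4) by (simp add: algebra_simps scaleC_diff_right cs_mult_scaleC_left cs_mult_scaleC_right)
  then have "(norm u)\<^sup>2 = 1" by (metis cs_cstar_identity norm_one)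
  then have nu: "norm u = 1" using power2_eq_imp_eq[of "norm u" 1] by simp
  have "u + cstar u = 2 *\<^sub>R c" unfolding su unfolding u_def by (simp add: scaleR_2)
  then have "2 * norm c = norm (u + cstar u)" by simp
  also have "\<dots> \<le> 2" using norm_triangle_ineq[of u "cstar u"] nu by simp
  finally show ?thesis by simp
qed

text \<open>Scaled to norm 1, the element \<open>k\<close> has a companion \<open>d\<close>
  commuting with it such that k^2 + d^2 = 1. Then \<open>d\<close> has norm at most 1, and so has
  d^2 = 1 - k^2, which is positivity of k^2 with witness 1.\<close>

lemma cpos_square:
  fixes c :: "'a::cstar_algebra_1"
  assumes "cstar c = c"
  shows "cpos (c * c)"
proof (cases "c = 0")
  case True
  then show ?thesis by (auto simp: cpos_def intro: exI[of _ 0])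
next
  case False
  define k where "k = (1 / norm c) *\<^sub>R c"
  have k: "norm k = 1" "cstar k = k" using False assms by (simp_all add: k_def cstar_scaleR)
  have "norm (k * k) \<le> 1" using norm_mult_ineq[of k k] k by simp
  then obtain d where d: "cstar d = d" "d * d = 1 - k * k"
    "\<And>z. z * (k * k) = (k * k) * z \<Longrightarrow> z * d = d * z"
    using sqrt_one_minus[of "k * k"] k by (metis cs_cstar_mult)
  have "k * d = d * k" using d(3)[of k] by (simp add: mult.assoc)
  then have "norm d \<le> 1" using norm_le_one_of_squares[of d k] d(1,2) k by simp
  then have "norm (1 *\<^sub>R 1 - k * k) \<le> 1"
    using norm_mult_ineq[of d d] mult_mono[of "norm d" 1 "norm d" 1] d(2) by simp
  then have "cpos (k * k)" unfolding cpos_def using k cs_cstar_mult by metis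
  then have "cpos ((norm c)\<^sup>2 *\<^sub>R (k * k))" by (rule cpos_scaleR) simp
  then show ?thesis using False by (simp add: k_def power2_eq_square)
qed

text \<open>The roots \<open>c\<close> and \<open>d\<close> commute, so ab = (cd)^2 is the square of
  a self-adjoint element.\<close>

lemma cpos_mult_commute:
  assumes "cpos a" "cpos b" "a * b = b * a"
  shows "cpos (a * b)"
proof -
  obtain c where c: "cpos c" "c * c = a" "\<And>z. z * a = a * z \<Longrightarrow> z * c = c * z"
    using cpos_sqrt assms by blast
  obtain d where d: "cpos d" "d * d = b" "\<And>z. z * b = b * z \<Longrightarrow> z * d = d * z"
    using cpos_sqrt assms by blast
  have "b * c = c * b" using c(3) assms by metis
  then have cd: "c * d = d * c" using d(3) by metis
  then have "cstar (c * d) = c * d" using c(1) d(1) by (simp add: cs_cstar_mult cpos_selfadj)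
  then have "cpos ((c * d) * (c * d))" by (rule cpos_square)
  moreover have "(c * d) * (c * d) = a * b" using cd c(2) d(2) by (metis mult.assoc)
  ultimately show ?thesis by simp
qed

text \<open>For s > norm b both a and s - a have roots; these commute and their squares add up to s,
  so the root of a has norm at most sqrt s. The slack \<open>e\<close> keeps s positive when b =
  0.\<close>

lemma cpos_norm_mono:
  assumes a: "cpos a" and ba: "cpos (b - a)"
  shows "norm a \<le> norm b"
proof (rule field_le_epsilon)
  fix e :: real assume e: "0 < e"
  define s where "s = norm b + e"
  have s: "s > 0" using e by (simp add: s_def add_nonneg_pos)
  have sb: "cstar b = b" using cpos_selfadj[OF cpos_add[OF a ba]] by simp
  have "cpos ((s *\<^sub>R 1 - b) + (b - a))" using e by (intro cpos_add cpos_norm_diff ba sb) (simp add: s_def)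
  then have "cpos (s *\<^sub>R 1 - a)" by simp
  then obtain d where d: "cpos d" "d * d = s *\<^sub>R 1 - a" "\<And>z. z * (s *\<^sub>R 1 - a) = (s *\<^sub>R 1 - a) * z \<Longrightarrow> z * d = d * z"
    using cpos_sqrt by blast
  obtain c where c: "cpos c" "c * c = a" using cpos_sqrt a by blast
  have "c * (s *\<^sub>R 1 - a) = (s *\<^sub>R 1 - a) * c" unfolding c(2)[symmetric] by (simp add: algebra_simps)
  then have cd: "c * d = d * c" by (rule d(3))
  have "norm ((1 / sqrt s) *\<^sub>R c) \<le> 1"
  proof (rule norm_le_one_of_squares[where d = "(1 / sqrt s) *\<^sub>R d"])
    show "(1 / sqrt s) *\<^sub>R c * (1 / sqrt s) *\<^sub>R c + (1 / sqrt s) *\<^sub>R d * (1 / sqrt s) *\<^sub>R d = 1"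
      using s by (simp add: c(2) d(2) algebra_simps)
  qed (use c(1) d(1) cd in \<open>simp_all add: cstar_scaleR cpos_selfadj\<close>)
  then have "norm c \<le> sqrt s" using s by (simp add: divide_simps)
  then have "norm c * norm c \<le> s" using s mult_mono[of "norm c" "sqrt s" "norm c" "sqrt s"] by simp
  then show "norm a \<le> norm b + e" using norm_mult_ineq[of c c] c(2) by (simp add: s_def)
qed

lemma cpos_antisym: "cpos a \<Longrightarrow> cpos (- a) \<Longrightarrow> a = 0"
  using cpos_norm_mono[of a 0] by simp

text \<open>\<open>h + v\<close> is \<open>|h|\<close>, so \<open>v\<close> is twice the negative part of \<open>h\<close>.  Positivity of \<open>v\<close> itself is not
  available at this stage, but that of \<open>v\<^sup>3 = 2|h|v\<^sup>2\<close> is.\<close>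

lemma abs_decomposition:
  fixes h :: "'a::cstar_algebra_1"
  assumes "cstar h = h"
  obtains v where "cstar v = v" "cpos (h + v)" "v * h = h * v" "v * v = - (2 *\<^sub>R (v * h))" "cpos (v * v * v)"
proof -
  obtain e where e: "cpos e" "e * e = h * h" "\<And>z. z * (h * h) = (h * h) * z \<Longrightarrow> z * e = e * z"
    using cpos_sqrt[OF cpos_square[OF assms]] by blast
  have he: "h * e = e * h" by (rule e(3)) (simp add: mult.assoc)
  define v where "v = e - h"
  have sv: "cstar v = v" by (simp add: v_def cstar_diff assms cpos_selfadj e)
  have vv: "v * v = - (2 *\<^sub>R (v * h))" "v * v = 2 *\<^sub>R (e * v)"
    using he e(2) by (simp_all add: v_def algebra_simps scaleR_2)
  have ev: "e * v = v * e" using he by (simp add: v_def algebra_simps)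
  then have "e * (v * v) = (v * v) * e" by (metis mult.assoc)
  then have "cpos (2 *\<^sub>R (e * (v * v)))"
    by (intro cpos_scaleR cpos_mult_commute e cpos_square sv) auto
  then have "cpos (v * v * v)" using vv(2) by (metis mult.assoc mult_scaleR_left)
  moreover have "v * h = h * v" using he by (simp add: v_def algebra_simps)
  ultimately show ?thesis using that[of v] sv vv(1) e(1) by (simp add: v_def)
qed

lemma selfadj_cube_zero:
  assumes "cstar v = (v::'a::cstar_algebra)" "v * v * v = 0"
  shows "v = 0"
proof -
  have "(v * v) * (v * v) = 0" using assms(2) by (metis mult.assoc mult_zero_left)
  then have "norm (v * v) = 0"
    using norm_square_selfadj[of "v * v"] assms(1) by (simp add: cs_cstar_mult)
  then show ?thesis using norm_square_selfadj[OF assms(1)] by simp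
qed

lemma cpos_cstar_mult: "cpos (cstar b * (b::'a::cstar_algebra_1))"
proof -
  define h where "h = cstar b * b"
  have sh: "cstar h = h" by (simp add: h_def cs_cstar_mult cs_cstar_cstar)
  obtain v where v: "cstar v = v" "cpos (h + v)" "v * h = h * v" "v * v = - (2 *\<^sub>R (v * h))" "cpos (v * v * v)"
    using abs_decomposition[OF sh] .
  \<comment> \<open>\<open>z\<^sup>*z = -p \<le> 0\<close> while \<open>q = zz\<^sup>* \<ge> 0\<close>; then \<open>qz = -zp\<close> gives \<open>(t - q)z = z(t + p)\<close>, and for
    large \<open>t\<close> this element has norm at most \<open>t\<parallel>z\<parallel>\<close>, which forces \<open>p = 0\<close>.\<close>
  define z where "z = b * v"
  define p where "p = (1/2) *\<^sub>R (v * v * v)"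
  define q where "q = z * cstar z"
  have p: "cpos p" unfolding p_def by (intro cpos_scaleR v) simp
  have "cstar z * z = v * h * v" by (simp add: z_def h_def cs_cstar_mult v mult.assoc)
  then have zz: "cstar z * z = - p" by (simp add: p_def v(4))
  \<comment> \<open>Real and imaginary parts: writing z' for \<open>cstar z\<close>, q - p = zz' +
    z'z is half of (z + z')^2 - (z - z')^2, a sum of squares of self-adjoint elements. Adding p
    \<ge> 0 makes q positive.\<close>
  have "cpos ((1/2) *\<^sub>R ((z + cstar z) * (z + cstar z))
      + ((1/2) *\<^sub>R (scaleC \<i> (z - cstar z) * scaleC \<i> (z - cstar z)) + p))"
    by (intro cpos_add cpos_scaleR cpos_square p)
      (simp_all add: cs_cstar_add cstar_diff cs_cstar_scaleC cs_cstar_cstar scaleC_minus_left scaleC_diff_right)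
  moreover have "scaleC \<i> (z - cstar z) * scaleC \<i> (z - cstar z) = - ((z - cstar z) * (z - cstar z))"
    by (simp add: cs_mult_scaleC_left cs_mult_scaleC_right cs_scaleC_scaleC scaleC_minus_left cs_scaleC_one)
  moreover have "(1/2) *\<^sub>R ((z + cstar z) * (z + cstar z)) + (- ((1/2) *\<^sub>R ((z - cstar z) * (z - cstar z))) + p) = q"
  proof -
    have "(z + cstar z) * (z + cstar z) - (z - cstar z) * (z - cstar z) = 2 *\<^sub>R (q - p)"
      using zz by (simp add: q_def algebra_simps scaleR_2)
    then have "(1/2) *\<^sub>R ((z + cstar z) * (z + cstar z) - (z - cstar z) * (z - cstar z)) = q - p" by simp
    then show ?thesis by (simp add: algebra_simps)
  qed
  ultimately have q: "cpos q" by simp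
  then obtain t0 where t0: "norm (t0 *\<^sub>R 1 - q) \<le> t0" unfolding cpos_def by blast
  \<comment> \<open>Raising \<open>t0\<close> by 1 keeps the inequality and makes division by
    \<open>t\<close> possible.\<close>
  define t where "t = t0 + 1"
  have "norm (t *\<^sub>R 1 - q) \<le> norm (t0 *\<^sub>R 1 - q) + norm (1::'a)"
    using norm_triangle_ineq[of "t0 *\<^sub>R 1 - q" 1] by (simp add: t_def algebra_simps)
  then have t: "norm (t *\<^sub>R 1 - q) \<le> t" "t > 0"
    using t0 order_trans[OF norm_ge_zero t0] by (simp_all add: t_def)
  define P where "P = norm p"
  have nz: "(norm z)\<^sup>2 = P" by (metis P_def cs_cstar_identity norm_minus_cancel zz)
  have "q * z = - (z * p)" by (simp add: q_def mult.assoc zz)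
  then have com: "(t *\<^sub>R 1 - q) * z = z * (t *\<^sub>R 1 + p)" by (simp add: algebra_simps)
  have "norm (z * (t *\<^sub>R 1 + p)) \<le> t * norm z"
    unfolding com[symmetric] using norm_mult_ineq[of "t *\<^sub>R 1 - q" z] mult_right_mono[OF t(1) norm_ge_zero[of z]] by linarith
  then have "(norm (z * (t *\<^sub>R 1 + p)))\<^sup>2 \<le> (t * norm z)\<^sup>2" by (intro power_mono) auto
  then have le: "(norm (z * (t *\<^sub>R 1 + p)))\<^sup>2 \<le> t\<^sup>2 * P" by (simp add: power_mult_distrib nz)
  \<comment> \<open>\<open>Y\<close> is (t + p)p(t + p) multiplied out. Up to sign it is the
    C*-square of z(t + p), so its norm is at most t^2 P.\<close>
  define Y where "Y = t\<^sup>2 *\<^sub>R p + (t *\<^sub>R (p * p) + t *\<^sub>R (p * p)) + p * (p * p)"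
  have sp: "cstar p = p" using p by (rule cpos_selfadj)
  have "cstar (z * (t *\<^sub>R 1 + p)) * (z * (t *\<^sub>R 1 + p)) = - ((t *\<^sub>R 1 + p) * p * (t *\<^sub>R 1 + p))"
  proof -
    have "cstar (z * (t *\<^sub>R 1 + p)) * (z * (t *\<^sub>R 1 + p)) = (t *\<^sub>R 1 + p) * (cstar z * z) * (t *\<^sub>R 1 + p)"
      by (simp add: cs_cstar_mult cs_cstar_add cstar_scaleR sp mult.assoc)
    then show ?thesis by (simp only: zz) simp
  qed
  also have "\<dots> = - Y" by (simp add: Y_def algebra_simps power2_eq_square)
  finally have "norm Y = (norm (z * (t *\<^sub>R 1 + p)))\<^sup>2" by (metis cs_cstar_identity norm_minus_cancel)
  then have nY: "norm Y \<le> t\<^sup>2 * P" using le by simp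
  have pp: "cpos (p * p)" "cpos (p * (p * p))"
    by (simp_all add: cpos_square sp cpos_mult_commute p mult.assoc)
  have "cstar Y = Y" by (simp add: Y_def cs_cstar_add cstar_scaleR cs_cstar_mult sp mult.assoc)
  then have "cpos ((1/t) *\<^sub>R (((t\<^sup>2 * P) *\<^sub>R 1 - Y) + p * (p * p)))"
    using nY t by (intro cpos_scaleR cpos_add cpos_norm_diff pp) auto
  \<comment> \<open>Adding p^3 to t^2 P - Y removes the cubic term; division by t leaves
    \<open>X\<close>.\<close>
  moreover define X where "X = (t * P) *\<^sub>R 1 - t *\<^sub>R p - (p * p + p * p)"
  have "(1/t) *\<^sub>R (((t\<^sup>2 * P) *\<^sub>R 1 - Y) + p * (p * p)) = X"
    using t by (simp add: X_def Y_def algebra_simps power2_eq_square)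
  ultimately have X: "cpos X" by simp
  \<comment> \<open>In PX + pX the terms linear in p cancel, and 2p^3 compensates the cubic one.
    What remains bounds (2P + t)p^2 by tP^2. Since p^2 has norm P^2, this forces P = 0.\<close>
  have "cpos (p * X)" by (intro cpos_mult_commute p X) (simp add: X_def algebra_simps)
  then have "cpos (P *\<^sub>R X + p * X + (p * (p * p) + p * (p * p)))"
    by (intro cpos_add cpos_scaleR pp X) (auto simp: P_def)
  moreover have "P *\<^sub>R X + p * X + (p * (p * p) + p * (p * p)) = (t * P * P) *\<^sub>R 1 - (P + P + t) *\<^sub>R (p * p)"
    by (simp only: scaleR_add_left) (simp add: X_def algebra_simps)
  ultimately have "cpos ((t * P * P) *\<^sub>R 1 - (P + P + t) *\<^sub>R (p * p))" by simp
  then have "norm ((P + P + t) *\<^sub>R (p * p)) \<le> norm ((t * P * P) *\<^sub>R (1::'a))"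
    using t by (intro cpos_norm_mono cpos_scaleR pp) (auto simp: P_def)
  then have "(P + P + t) * P\<^sup>2 \<le> t * P * P"
    using t norm_square_selfadj[OF sp] by (simp add: P_def)
  then have "P * P * P \<le> 0" by (simp add: algebra_simps power2_eq_square)
  then have "P = 0" by (metis P_def mult_le_0_iff norm_ge_zero nle_le)
  then have "v * v * v = 0" by (simp add: P_def p_def)
  then have "v = 0" using selfadj_cube_zero v(1) by blast
  then show ?thesis using v(2) by (simp add: h_def)
qed

lemma cpos_conj:
  assumes "cpos a"
  shows "cpos (cstar c * a * c)"
proof -
  obtain w where w: "cpos w" "w * w = a" using cpos_sqrt assms by blast
  have "cstar c * a * c = cstar (w * c) * (w * c)"
    unfolding w(2)[symmetric] by (simp add: cs_cstar_mult cpos_selfadj[OF w(1)] mult.assoc)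
  then show ?thesis by (simp add: cpos_cstar_mult)
qed

subsection \<open>Unitization\<close>

lemma bounded_linear_left_mult_scaleC:
  "bounded_linear (\<lambda>x. a * x + scaleC c x :: 'a::cstar_algebra)"
proof (rule bounded_linear_intro[where K = "norm a + cmod c"])
  show "norm (a * x + scaleC c x) \<le> norm x * (norm a + cmod c)" for x
    using norm_triangle_ineq[of "a * x" "scaleC c x"] norm_mult_ineq[of a x]
    by (simp add: cs_norm_scaleC algebra_simps)
qed (simp_all add: cs_scaleC_add_right algebra_simps cs_scaleR_scaleC cs_mult_scaleC_right cs_scaleC_scaleC)

lemma scaleC_zero_left [simp]: "scaleC 0 (x::'a::cstar_algebra) = 0"
  using cs_scaleR_scaleC[of 0 x] by simp

text \<open>The test element is \<open>cstar a\<close>, where the C*-identity computes the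
  product.\<close>

lemma norm_le_of_left_mult:
  assumes "\<And>x. norm (a * x) \<le> K * norm x" "0 \<le> K"
  shows "norm (a::'a::cstar_algebra) \<le> K"
proof (cases "a = 0")
  case False
  have "norm a * norm a \<le> K * norm a"
    using assms(1)[of "cstar a"] by (simp add: norm_mult_cstar power2_eq_square)
  then show ?thesis using False by simp
qed (use assms in simp)

text \<open>The norm on \<open>A \<times> \<complex>\<close> takes the scalar into account as well, so that it is a norm
  even if \<open>A\<close> already has a unit.\<close>

datatype 'a cunit = Cunit (cu_elt: 'a) (cu_scal: complex)

text \<open>The unitization acts on \<open>A\<close>, an ideal in it, by left multiplication. The
  operator norm of this action is the part of the norm that sees \<open>A\<close>.\<close>

definition cu_op :: "'a::cstar_algebra cunit \<Rightarrow> 'a \<Rightarrow>\<^sub>L 'a" where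
  "cu_op p = Blinfun (\<lambda>x. cu_elt p * x + scaleC (cu_scal p) x)"

lemma cu_op_apply [simp]: "blinfun_apply (cu_op p) x = cu_elt p * x + scaleC (cu_scal p) x"
  unfolding cu_op_def by (simp add: bounded_linear_Blinfun_apply bounded_linear_left_mult_scaleC)

instantiation cunit :: (cstar_algebra) real_normed_algebra_1
begin

definition "0 = Cunit (0::'a) 0"
definition "1 = Cunit (0::'a) 1"
definition "p + q = Cunit (cu_elt p + cu_elt q :: 'a) (cu_scal p + cu_scal q)"
definition "p - q = Cunit (cu_elt p - cu_elt q :: 'a) (cu_scal p - cu_scal q)"
definition "- p = Cunit (- cu_elt p :: 'a) (- cu_scal p)"
definition "r *\<^sub>R p = Cunit (r *\<^sub>R cu_elt p :: 'a) (r *\<^sub>R cu_scal p)"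
definition "p * q = Cunit (cu_elt p * cu_elt q + scaleC (cu_scal p) (cu_elt q)
  + scaleC (cu_scal q) (cu_elt p) :: 'a) (cu_scal p * cu_scal q)"
definition norm_cunit :: "'a cunit \<Rightarrow> real" where
  "norm_cunit p = max (norm (cu_op p)) (cmod (cu_scal p))"
definition "sgn p = inverse (norm p) *\<^sub>R (p :: 'a cunit)"
definition "dist p q = norm (p - q :: 'a cunit)"
definition "(uniformity :: ('a cunit \<times> 'a cunit) filter) =
  (INF e\<in>{0 <..}. principal {(x, y). dist x y < e})"
definition "open (U :: 'a cunit set) =
  (\<forall>x\<in>U. eventually (\<lambda>(x', y). x' = x \<longrightarrow> y \<in> U) uniformity)"

lemmas cunit_defs = zero_cunit_def one_cunit_def plus_cunit_def minus_cunit_def uminus_cunit_def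
  scaleR_cunit_def times_cunit_def

lemma cunit_sel [simp]:
  fixes p q :: "'a cunit"
  shows "cu_elt (0::'a cunit) = 0" "cu_scal (0::'a cunit) = 0"
    "cu_elt (1::'a cunit) = 0" "cu_scal (1::'a cunit) = 1"
    "cu_elt (p + q) = cu_elt p + cu_elt q" "cu_scal (p + q) = cu_scal p + cu_scal q"
    "cu_elt (p - q) = cu_elt p - cu_elt q" "cu_scal (p - q) = cu_scal p - cu_scal q"
    "cu_elt (- p) = - cu_elt p" "cu_scal (- p) = - cu_scal p"
    "cu_elt (r *\<^sub>R p) = r *\<^sub>R cu_elt p" "cu_scal (r *\<^sub>R p) = r *\<^sub>R cu_scal p"
    "cu_elt (p * q) = cu_elt p * cu_elt q + scaleC (cu_scal p) (cu_elt q) + scaleC (cu_scal q) (cu_elt p)"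
    "cu_scal (p * q) = cu_scal p * cu_scal q"
  by (simp_all add: cunit_defs)

lemma cu_op_linear:
  fixes p q :: "'a cunit"
  shows "cu_op (p + q) = cu_op p + cu_op q" "cu_op (r *\<^sub>R p) = r *\<^sub>R cu_op p"
    "cu_op (p * q) = cu_op p o\<^sub>L cu_op q"
  by (rule blinfun_eqI; simp add: blinfun.add_left blinfun.scaleR_left algebra_simps
      cs_scaleC_add_left cs_scaleC_add_right cs_mult_scaleC_left cs_mult_scaleC_right
      cs_scaleC_scaleC cs_scaleR_scaleC scaleR_conv_of_real)+

text \<open>Controls the \<open>A\<close> component by the norm, which gives definiteness and later
  completeness.\<close>

lemma norm_elt_le: "norm (cu_elt p) \<le> norm (cu_op p) + cmod (cu_scal p)"
proof (rule norm_le_of_left_mult)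
  fix x
  have "norm (cu_elt p * x) \<le> norm (cu_op p x) + norm (scaleC (cu_scal p) x)"
    using norm_triangle_ineq4[of "cu_op p x" "scaleC (cu_scal p) x"] by simp
  also have "\<dots> \<le> (norm (cu_op p) + cmod (cu_scal p)) * norm x"
    using norm_blinfun[of "cu_op p" x] by (simp add: cs_norm_scaleC algebra_simps)
  finally show "norm (cu_elt p * x) \<le> (norm (cu_op p) + cmod (cu_scal p)) * norm x" .
qed simp

instance
proof
  fix p q s :: "'a cunit" and r t :: real
  show "norm p = 0 \<longleftrightarrow> p = 0"
  proof
    assume "norm p = 0"
    then have "norm (cu_op p) \<le> 0" "cmod (cu_scal p) \<le> 0" unfolding norm_cunit_def by linarith+
    then show "p = 0" using norm_elt_le[of p] by (simp add: cunit.expand)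
  next
    assume "p = 0"
    moreover have "cu_op (0::'a cunit) = 0" by (rule blinfun_eqI) simp
    ultimately show "norm p = 0" by (simp add: norm_cunit_def)
  qed
  show "norm (p + q) \<le> norm p + norm q"
    using norm_triangle_ineq[of "cu_op p" "cu_op q"] norm_triangle_ineq[of "cu_scal p" "cu_scal q"]
    unfolding norm_cunit_def cu_op_linear by (simp add: max_def)
  show "norm (r *\<^sub>R p) = \<bar>r\<bar> * norm p"
    unfolding norm_cunit_def cu_op_linear by (simp add: max_mult_distrib_left norm_mult)
  show "norm (p * q) \<le> norm p * norm q"
    unfolding norm_cunit_def cu_op_linear cunit_sel norm_mult
    by (rule max.boundedI[OF order_trans[OF norm_blinfun_compose]]; rule mult_mono)
       (simp_all add: le_max_iff_disj)
  have "norm (cu_op (1::'a cunit)) \<le> 1"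
    by (rule norm_blinfun_bound) (simp_all add: cs_scaleC_one)
  then show "norm (1::'a cunit) = 1" by (simp add: norm_cunit_def)
qed (simp_all add: sgn_cunit_def dist_cunit_def uniformity_cunit_def open_cunit_def cunit_defs
      algebra_simps cs_scaleC_add_left cs_scaleC_add_right cs_mult_scaleC_left cs_mult_scaleC_right
      cs_scaleC_scaleC cs_scaleR_scaleC scaleR_conv_of_real cs_scaleC_one cunit.expand)

end

text \<open>The norm is equivalent to the sum norm on A \<times> \<complex>, from which completeness
  is inherited.\<close>

lemma cu_norm_bounds:
  "norm (cu_op p) \<le> norm p" "cmod (cu_scal p) \<le> norm p" "norm (cu_elt p) \<le> 2 * norm p"
  "norm p \<le> norm (cu_elt p) + cmod (cu_scal p)"
proof -
  show a: "norm (cu_op p) \<le> norm p" "cmod (cu_scal p) \<le> norm p" by (simp_all add: norm_cunit_def)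
  then show "norm (cu_elt p) \<le> 2 * norm p" using norm_elt_le[of p] by linarith
  have "norm (cu_op p) \<le> norm (cu_elt p) + cmod (cu_scal p)"
  proof (rule norm_blinfun_bound)
    show "norm (cu_op p x) \<le> (norm (cu_elt p) + cmod (cu_scal p)) * norm x" for x
      using norm_triangle_ineq[of "cu_elt p * x" "scaleC (cu_scal p) x"] norm_mult_ineq[of "cu_elt p" x]
      by (simp add: cs_norm_scaleC algebra_simps)
  qed simp
  then show "norm p \<le> norm (cu_elt p) + cmod (cu_scal p)" by (simp add: norm_cunit_def)
qed

instance cunit :: (cstar_algebra) banach
proof
  fix X :: "nat \<Rightarrow> 'a cunit"
  assume X: "Cauchy X"
  have "Cauchy (\<lambda>n. cu_scal (X n))" "Cauchy (\<lambda>n. cu_elt (X n))"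
  proof -
    have b: "norm (cu_scal (X m) - cu_scal (X n)) \<le> 2 * norm (X m - X n)"
      "norm (cu_elt (X m) - cu_elt (X n)) \<le> 2 * norm (X m - X n)" for m n
      using cu_norm_bounds(2,3)[of "X m - X n"] norm_ge_zero[of "X m - X n"]
      unfolding cunit_sel by linarith+
    have c: "\<exists>M. \<forall>m\<ge>M. \<forall>n\<ge>M. 2 * norm (X m - X n) < e" if e: "e > 0" for e :: real
      using CauchyD[OF X, of "e/2"] e by (auto simp: field_simps)
    show "Cauchy (\<lambda>n. cu_scal (X n))" "Cauchy (\<lambda>n. cu_elt (X n))"
      by (rule CauchyI, use b c order_le_less_trans in meson)+
  qed
  then obtain l a where l: "(\<lambda>n. cu_scal (X n)) \<longlonglongrightarrow> l" and a: "(\<lambda>n. cu_elt (X n)) \<longlonglongrightarrow> a"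
    by (auto simp: Cauchy_convergent_iff convergent_def)
  have z: "(\<lambda>n. norm (cu_elt (X n) - a) + cmod (cu_scal (X n) - l)) \<longlonglongrightarrow> 0"
    using tendsto_add[OF tendsto_norm[OF LIM_zero[OF a]] tendsto_norm[OF LIM_zero[OF l]]] by simp
  have "norm (X n - Cunit a l) \<le> norm (norm (cu_elt (X n) - a) + cmod (cu_scal (X n) - l)) * 1" for n
    using cu_norm_bounds(4)[of "X n - Cunit a l"] by simp
  then have "(\<lambda>n. X n - Cunit a l) \<longlonglongrightarrow> 0"
    by (intro tendsto_0_le[OF z, where K = 1] always_eventually) blast
  then show "convergent X" using LIM_zero_cancel convergent_def by blast
qed

instantiation cunit :: (cstar_algebra) cstar_algebra_1
begin

definition "scaleC c p = Cunit (scaleC c (cu_elt p) :: 'a) (c * cu_scal p)"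
definition "cstar p = Cunit (cstar (cu_elt p) :: 'a) (cnj (cu_scal p))"

lemma cunit_sel_star [simp]:
  "cu_elt (scaleC c p) = scaleC c (cu_elt (p::'a cunit))" "cu_scal (scaleC c p) = c * cu_scal p"
  "cu_elt (cstar p) = cstar (cu_elt p)" "cu_scal (cstar p) = cnj (cu_scal p)"
  by (simp_all add: scaleC_cunit_def cstar_cunit_def)

instance
proof
  fix p q :: "'a cunit" and c d :: complex and r :: real
  show "r *\<^sub>R p = scaleC (complex_of_real r) p"
    by (rule cunit.expand, unfold cunit_sel cunit_sel_star) (simp add: cs_scaleR_scaleC scaleR_conv_of_real)
  have "norm (cu_op (scaleC c p)) = cmod c * norm (cu_op p)" for c and p :: "'a cunit"
  proof -
    have le: "norm (cu_op (scaleC c p)) \<le> cmod c * norm (cu_op p)" for c and p :: "'a cunit"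
    proof (rule norm_blinfun_bound)
      fix x
      have "cu_op (scaleC c p) x = scaleC c (cu_op p x)"
        by (simp add: cs_scaleC_add_right cs_mult_scaleC_left cs_scaleC_scaleC)
      then show "norm (cu_op (scaleC c p) x) \<le> cmod c * norm (cu_op p) * norm x"
        using mult_left_mono[OF norm_blinfun[of "cu_op p" x], of "cmod c"]
        by (simp add: cs_norm_scaleC mult.assoc)
    qed simp
    show ?thesis
    proof (cases "c = 0")
      case False
      have "scaleC (inverse c) (scaleC c p) = p"
        using False by (simp add: cunit.expand cs_scaleC_scaleC cs_scaleC_one mult.assoc[symmetric])
      then have "norm (cu_op p) \<le> inverse (cmod c) * norm (cu_op (scaleC c p))"
        using le[of "inverse c" "scaleC c p"] by (simp add: norm_inverse)
      then show ?thesis using le[of c p] False by (simp add: field_simps)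
    qed (use le[of c p] in simp)
  qed
  then show "norm (scaleC c p) = cmod c * norm p"
    by (simp add: norm_cunit_def norm_mult max_mult_distrib_left)
  \<comment> \<open>The substantial half of the C*-identity, obtained from that of \<open>A\<close>:
    norm (px)^2 is the norm of \<open>cstar x\<close> times ((\<open>cstar p\<close> p) x).
    Submultiplicativity then gives \<open>norm p \<le> norm (cstar p)\<close>, equality by symmetry,
    and with it the other half.\<close>
  have le: "(norm p)\<^sup>2 \<le> norm (cstar p * p)" for p :: "'a cunit"
  proof -
    have "norm (cu_op p x) \<le> sqrt (norm (cu_op (cstar p * p))) * norm x" for x
    proof -
      have "cstar (cu_op p x) * cu_op p x = cstar x * cu_op (cstar p * p) x"
        by (simp add: cs_cstar_add cs_cstar_mult cs_cstar_scaleC algebra_simps cs_scaleC_add_right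
            cs_scaleC_add_left cs_mult_scaleC_left cs_mult_scaleC_right cs_scaleC_scaleC)
      then have "(norm (cu_op p x))\<^sup>2 = norm (cstar x * cu_op (cstar p * p) x)" by (metis cs_cstar_identity)
      also have "\<dots> \<le> norm x * (norm (cu_op (cstar p * p)) * norm x)"
        using norm_mult_ineq[of "cstar x" "cu_op (cstar p * p) x"]
          mult_left_mono[OF norm_blinfun[of "cu_op (cstar p * p)" x] norm_ge_zero[of x]] by simp
      also have "\<dots> = (sqrt (norm (cu_op (cstar p * p))) * norm x)\<^sup>2"
        by (simp add: power_mult_distrib power2_eq_square)
      finally show ?thesis by (rule power2_le_imp_le) simp
    qed
    then have "norm (cu_op p) \<le> sqrt (norm (cu_op (cstar p * p)))" by (intro norm_blinfun_bound) auto
    then have "(norm (cu_op p))\<^sup>2 \<le> norm (cu_op (cstar p * p))"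
      by (metis norm_ge_zero power_mono real_sqrt_pow2)
    moreover have "(cmod (cu_scal p))\<^sup>2 = cmod (cu_scal (cstar p * p))"
      by (simp add: norm_mult power2_eq_square)
    ultimately show ?thesis by (auto simp: norm_cunit_def max_def)
  qed
  have ss: "cstar (cstar p) = p" for p :: "'a cunit" by (simp add: cunit.expand cs_cstar_cstar)
  have le2: "norm p \<le> norm (cstar p)" for p :: "'a cunit"
  proof (cases "p = 0")
    case False
    have "norm p * norm p \<le> norm (cstar p) * norm p"
      using le[of p] norm_mult_ineq[of "cstar p" p] by (simp add: power2_eq_square)
    then show ?thesis using False by simp
  qed simp
  have "norm (cstar p) = norm p" using le2[of p] le2[of "cstar p"] by (simp add: ss)
  then show "norm (cstar p * p) = (norm p)\<^sup>2"
    using le[of p] norm_mult_ineq[of "cstar p" p] by (simp add: power2_eq_square)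
qed (simp_all add: cunit.expand cs_scaleC_add_left cs_scaleC_add_right cs_mult_scaleC_left
      cs_mult_scaleC_right cs_scaleC_scaleC cs_scaleR_scaleC scaleR_conv_of_real cs_scaleC_one
      cs_cstar_add cs_cstar_mult cs_cstar_scaleC cs_cstar_cstar algebra_simps)

end

definition cu_emb :: "'a::cstar_algebra \<Rightarrow> 'a cunit" where
  "cu_emb a = Cunit a 0"

lemma cu_emb_simps:
  fixes a b :: "'a::cstar_algebra"
  shows "cu_emb (a + b) = cu_emb a + cu_emb b" "cu_emb (a - b) = cu_emb a - cu_emb b"
    "cu_emb (a * b) = cu_emb a * cu_emb b" "cu_emb (cstar a) = cstar (cu_emb a)"
    "cu_emb (r *\<^sub>R a) = r *\<^sub>R cu_emb a" "cu_emb (0::'a) = 0"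
  by (simp_all add: cu_emb_def cunit.expand)

lemma cu_emb_inject: "cu_emb a = cu_emb b \<longleftrightarrow> a = b"
  by (simp add: cu_emb_def)

lemma norm_cu_emb [simp]: "norm (cu_emb a) = norm (a::'a::cstar_algebra)"
proof (rule antisym)
  show "norm (cu_emb a) \<le> norm a" using cu_norm_bounds(4)[of "cu_emb a"] by (simp add: cu_emb_def)
  have "norm a \<le> norm (cu_op (cu_emb a))" using norm_elt_le[of "cu_emb a"] by (simp add: cu_emb_def)
  then show "norm a \<le> norm (cu_emb a)" using cu_norm_bounds(1)[of "cu_emb a"] by linarith
qed

lemma mult_cu_emb: "p * cu_emb x = cu_emb (blinfun_apply (cu_op p) x)"
  by (simp add: cu_emb_def cunit.expand)

text \<open>A root of an embedded element has a scalar part of square zero, so it already lies in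
  \<open>A\<close>.\<close>

lemma cs_positive_iff_cpos: "cs_positive (a::'a::cstar_algebra) \<longleftrightarrow> cpos (cu_emb a)"
proof
  assume "cs_positive a"
  then show "cpos (cu_emb a)" by (auto simp: cs_positive_def cu_emb_simps cpos_cstar_mult)
next
  assume "cpos (cu_emb a)"
  then obtain w where w: "cpos w" "w * w = cu_emb a" using cpos_sqrt by blast
  have "cu_scal w * cu_scal w = 0" using arg_cong[OF w(2), of cu_scal] by (simp add: cu_emb_def)
  then have "w = cu_emb (cu_elt w)" by (simp add: cu_emb_def cunit.expand)
  then have "cu_emb a = cu_emb (cstar (cu_elt w) * cu_elt w)"
    using w cpos_selfadj[OF w(1)] by (simp add: cu_emb_simps)
  then show "cs_positive a" by (auto simp: cs_positive_def cu_emb_inject)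
qed

lemma cs_positive_norm_mono:
  "cs_positive a \<Longrightarrow> cs_positive (b - a) \<Longrightarrow> norm a \<le> norm (b::'a::cstar_algebra)"
  using cpos_norm_mono[of "cu_emb a" "cu_emb b"] by (simp add: cs_positive_iff_cpos cu_emb_simps)

section \<open>Approximate units in closed ideals\<close>

lemma norm_power_compression:
  fixes h :: "'a::cstar_algebra_1"
  assumes h: "cpos h" "norm h \<le> 1"
  shows "real k * norm ((1 - h) ^ k * h * (1 - h) ^ k) \<le> 1"
proof -
  define g where "g = 1 - h"
  have sh: "cstar h = h" by (rule cpos_selfadj[OF h(1)])
  have g: "cpos g" using cpos_norm_diff[OF sh h(2)] by (simp add: g_def)
  have sg: "cstar (g ^ k) = g ^ k" for k using cpos_selfadj[OF g] by (simp add: cstar_power)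
  have h2: "cpos (h * g * h + h * h)"
    using cpos_add[OF cpos_conj[OF g, of h] cpos_square[OF sh]] by (simp add: sh)
  have hg: "cpos (h * g)" by (intro cpos_mult_commute h g) (simp add: g_def algebra_simps)
  \<comment> \<open>The bound comes from 1 - g^(2k) \<ge> k g^k h g^k, by induction on k. Each
    increment of the difference is the compression by g^k of the left side, which this identity
    rewrites as a visibly positive element.\<close>
  have step: "1 - g * g + c *\<^sub>R h - (c + 1) *\<^sub>R (g * h * g) = h * g + (c + 1) *\<^sub>R (h * g * h + h * h)" for c
    by (simp add: g_def algebra_simps scaleR_2)
  have pos: "cpos (1 - g ^ k * g ^ k - real k *\<^sub>R (g ^ k * h * g ^ k))"
  proof (induction k)
    case (Suc k)
    have "1 - (p * g) * (g * p) - (c + 1) *\<^sub>R ((p * g) * h * (g * p))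
      = (1 - p * p - c *\<^sub>R (p * h * p)) + p * (1 - g * g + c *\<^sub>R h - (c + 1) *\<^sub>R (g * h * g)) * p" for p c
      by (simp add: algebra_simps)
    from this[of "g ^ k" "real k"]
    have "1 - g ^ Suc k * g ^ Suc k - real (Suc k) *\<^sub>R (g ^ Suc k * h * g ^ Suc k)
      = (1 - g ^ k * g ^ k - real k *\<^sub>R (g ^ k * h * g ^ k))
        + g ^ k * (1 - g * g + real k *\<^sub>R h - (real k + 1) *\<^sub>R (g * h * g)) * g ^ k"
      by (simp only: power_Suc[symmetric] power_Suc2[symmetric] of_nat_Suc add.commute)
    also have "cpos \<dots>"
    proof (intro cpos_add Suc)
      have "cpos (cstar (g ^ k) * (h * g + (real k + 1) *\<^sub>R (h * g * h + h * h)) * g ^ k)"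
        by (intro cpos_conj cpos_add cpos_scaleR hg h2) simp
      then show "cpos (g ^ k * (1 - g * g + real k *\<^sub>R h - (real k + 1) *\<^sub>R (g * h * g)) * g ^ k)"
        unfolding step sg .
    qed
    finally show ?case .
  next
    case 0
    show ?case using cpos_square[of "0::'a"] by simp
  qed
  have "cpos (cstar (g ^ k) * h * g ^ k)" by (intro cpos_conj h)
  then have q: "cpos (real k *\<^sub>R (g ^ k * h * g ^ k))" unfolding sg by (rule cpos_scaleR) simp
  have "cpos (cstar (g ^ k) * g ^ k)" by (rule cpos_cstar_mult)
  then have "cpos (g ^ k * g ^ k)" by (simp add: sg)
  from cpos_add[OF pos this] have "norm (real k *\<^sub>R (g ^ k * h * g ^ k)) \<le> norm (1::'a)"
    by (intro cpos_norm_mono q) simp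
  then show ?thesis by (simp add: g_def)
qed

text \<open>With h a multiple of \<open>cstar b * b\<close>, the error is b(1 - h)^k. Its squared
  norm is a multiple of the norm of (1 - h)^k h (1 - h)^k, hence of order 1/k.\<close>

lemma ideal_approximate_unit:
  fixes b :: "'a::cstar_algebra"
  assumes J: "cstar_ideal J" and bJ: "cstar b * b \<in> J"
  obtains e where "\<And>k. e k \<in> J" "\<And>k. cstar (e k) = e k" "(\<lambda>k. b * e k) \<longlonglongrightarrow> b"
proof -
  \<comment> \<open>The factor scales \<open>h\<close> to norm at most 1; the summand 1 in the
    denominator covers b = 0.\<close>
  define t where "t = 1 / (1 + (norm b)\<^sup>2)"
  have t: "t > 0" "t * (norm b)\<^sup>2 \<le> 1" by (simp_all add: t_def divide_simps add_pos_nonneg)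
  define h where "h = t *\<^sub>R (cstar b * b)"
  have hJ: "h \<in> J" using J bJ unfolding cstar_ideal_def h_def cs_scaleR_scaleC by blast
  have ph: "cpos (cu_emb h)" unfolding h_def cu_emb_simps using t by (intro cpos_scaleR cpos_cstar_mult) simp
  have nh: "norm (cu_emb h) \<le> 1" using t by (simp add: h_def cs_cstar_identity)
  \<comment> \<open>The recursion for 1 - (1 - h)^k written without a unit, so that it stays inside
    \<open>J\<close>.\<close>
  define e where "e = rec_nat 0 (\<lambda>_ v. v + (h + scaleC (-1) (h * v)))"
  have e0: "e 0 = 0" and eS: "e (Suc k) = e k + (h + scaleC (-1) (h * e k))" for k by (simp_all add: e_def)
  have eJ: "e k \<in> J" for k
  proof (induction k)
    case (Suc k)
    then show ?case using J hJ unfolding eS cstar_ideal_def by blast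
  qed (use J in \<open>simp add: e0 cstar_ideal_def\<close>)
  define g where "g = 1 - cu_emb h"
  have eg: "cu_emb (e k) = 1 - g ^ k" for k
  proof (induction k)
    case (Suc k)
    have "scaleC (-1) (h * e k) = - (h * e k)" by (simp add: scaleC_minus_left cs_scaleC_one)
    then show ?case by (simp add: eS cu_emb_simps Suc g_def algebra_simps)
  qed (simp add: e0 cu_emb_simps)
  have sg: "cstar (g ^ k) = g ^ k" for k
    by (simp add: cstar_power g_def cstar_diff cpos_selfadj[OF ph])
  have "cu_emb (cstar (e k)) = cu_emb (e k)" for k by (simp add: cu_emb_simps(4) eg cstar_diff sg)
  then have se: "cstar (e k) = e k" for k by (simp add: cu_emb_inject)
  have bound: "(norm (b - b * e k))\<^sup>2 \<le> (1 / t) * inverse (real k)" if "k > 0" for k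
  proof -
    have "cu_emb (b - b * e k) = cu_emb b * g ^ k" by (simp add: cu_emb_simps eg algebra_simps)
    then have "(norm (b - b * e k))\<^sup>2 = norm (cstar (cu_emb b * g ^ k) * (cu_emb b * g ^ k))"
      by (metis cs_cstar_identity norm_cu_emb)
    also have "cstar (cu_emb b * g ^ k) * (cu_emb b * g ^ k) = (1 / t) *\<^sub>R (g ^ k * cu_emb h * g ^ k)"
      using t by (simp add: h_def cu_emb_simps cs_cstar_mult sg mult.assoc)
    also have "norm \<dots> = (1 / t) * norm (g ^ k * cu_emb h * g ^ k)" using t by simp
    also have "\<dots> \<le> (1 / t) * inverse (real k)"
      using norm_power_compression[OF ph nh, of k] t that
      by (intro mult_left_mono) (simp_all add: g_def divide_simps mult.commute)
    finally show ?thesis .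
  qed
  have lim: "(\<lambda>k. (1 / t) * inverse (real k)) \<longlonglongrightarrow> 0"
    using tendsto_mult_right_zero[OF lim_inverse_n] .
  have "(\<lambda>k. (norm (b - b * e k))\<^sup>2) \<longlonglongrightarrow> 0"
    by (rule tendsto_sandwich[OF _ _ tendsto_const lim])
       (use bound in \<open>auto intro!: eventually_sequentiallyI[of 1]\<close>)
  then have "(\<lambda>k. sqrt ((norm (b - b * e k))\<^sup>2)) \<longlonglongrightarrow> sqrt 0" by (rule tendsto_real_sqrt)
  then have "(\<lambda>k. b - b * e k) \<longlonglongrightarrow> 0" by (simp add: tendsto_norm_zero_iff)
  from tendsto_diff[OF tendsto_const[of b] this] have "(\<lambda>k. b * e k) \<longlonglongrightarrow> b" by simp
  then show ?thesis using that[of e] eJ se by blast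
qed

text \<open>As x e_k tends to x with self-adjoint e_k in \<open>J\<close>, \<open>cstar x\<close> is
  the limit of the elements \<open>e k * cstar x\<close> of \<open>J\<close>.\<close>

lemma ideal_cstar:
  assumes J: "cstar_ideal J" and x: "x \<in> J"
  shows "cstar x \<in> (J :: 'a::cstar_algebra set)"
proof -
  have "cstar x * x \<in> J" using assms by (auto simp: cstar_ideal_def)
  then obtain e where e: "\<And>k. e k \<in> J" "\<And>k. cstar (e k) = e k" "(\<lambda>k. x * e k) \<longlonglongrightarrow> x"
    using ideal_approximate_unit[OF J] by metis
  have "(\<lambda>k. e k * cstar x) \<longlonglongrightarrow> cstar x"
    using tendsto_cstar[OF e(3)] by (simp add: cs_cstar_mult e(2))
  moreover have "e k * cstar x \<in> J" for k using J e(1)[of k] by (auto simp: cstar_ideal_def)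
  moreover have "closed J" using J by (simp add: cstar_ideal_def)
  ultimately show ?thesis using closed_sequentially[of J "\<lambda>k. e k * cstar x"] by blast
qed

section \<open>Testing positivity and norms against an essential ideal\<close>

lemma essential_ideal_unitization:
  assumes J: "cstar_ideal J" "essential_ideal J" and v: "\<And>x. x \<in> J \<Longrightarrow> v * cu_emb x = 0"
  shows "v * cu_emb (c::'a::cstar_algebra) = 0"
proof -
  \<comment> \<open>Essentiality applies to vc, which lies in \<open>A\<close>. The factor
    \<open>v\<close> itself may be nonzero: if \<open>A\<close> has a unit, its difference from the
    adjoined unit annihilates \<open>A\<close>.\<close>
  have "cu_op v c * x = 0" if "x \<in> J" for x
  proof -
    have "c * x \<in> J" using J(1) that by (auto simp: cstar_ideal_def)
    then have "cu_emb (cu_op v c * x) = 0"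
      using v[of "c * x"] by (simp only: cu_emb_simps(3) mult_cu_emb[symmetric] mult.assoc)
    then show ?thesis by (metis cu_emb_simps(6) cu_emb_inject)
  qed
  then have "cu_op v c = 0" using J(2) unfolding essential_ideal_def by blast
  then show ?thesis unfolding mult_cu_emb by (simp only: cu_emb_simps)
qed

lemma cu_op_ideal: "cstar_ideal J \<Longrightarrow> x \<in> J \<Longrightarrow> cu_op p x \<in> J"
  unfolding cu_op_apply cstar_ideal_def by blast

text \<open>For v, twice the negative part of a, v a v = -v^3/2. Testing positivity at vx shows that
  v^3 compressed by x is both positive and negative, so v^3 annihilates \<open>J\<close> and hence
  a. As v^4 = -2 v^3 a, v vanishes.\<close>

lemma cs_positive_by_compression:
  fixes a :: "'a::cstar_algebra"
  assumes J: "cstar_ideal J" "essential_ideal J" and sa: "cstar a = a"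
    and pos: "\<And>x. x \<in> J \<Longrightarrow> cs_positive (cstar x * a * x)"
  shows "cs_positive a"
proof -
  have "cstar (cu_emb a) = cu_emb a" by (metis cu_emb_simps(4) sa)
  then obtain v where v: "cstar v = v" "cpos (cu_emb a + v)" "v * cu_emb a = cu_emb a * v"
    "v * v = - (2 *\<^sub>R (v * cu_emb a))" "cpos (v * v * v)" by (rule abs_decomposition)
  have vav: "v * cu_emb a * v = - ((1/2) *\<^sub>R (v * v * v))"
    by (simp add: v(4) v(3)[symmetric] mult.assoc)
  have "v * v * v * cu_emb x = 0" if x: "x \<in> J" for x
  proof -
    let ?X = "cu_emb x"
    have "cpos (cu_emb (cstar (cu_op v x) * a * cu_op v x))"
      using pos[OF cu_op_ideal[OF J(1) x]] by (simp only: cs_positive_iff_cpos)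
    also have "cu_emb (cstar (cu_op v x) * a * cu_op v x) = cstar ?X * (v * cu_emb a * v) * ?X"
      by (simp only: cu_emb_simps mult_cu_emb[symmetric] cs_cstar_mult v(1) mult.assoc)
    also have "\<dots> = - ((1/2) *\<^sub>R (cstar ?X * (v * v * v) * ?X))" unfolding vav by simp
    finally have "cpos (2 *\<^sub>R (- ((1/2) *\<^sub>R (cstar ?X * (v * v * v) * ?X))))" by (rule cpos_scaleR) simp
    then have "cpos (- (cstar ?X * (v * v * v) * ?X))" by simp
    then have z: "cstar ?X * (v * v * v) * ?X = 0" using cpos_antisym[OF cpos_conj[OF v(5)]] by blast
    \<comment> \<open>The root passes from the vanishing of the compressed v^3 to that of v^3
      x.\<close>
    obtain r where r: "cpos r" "r * r = v * v * v" using cpos_sqrt[OF v(5)] by blast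
    have "cstar (r * ?X) * (r * ?X) = cstar ?X * (r * r) * ?X"
      by (simp add: cs_cstar_mult cpos_selfadj[OF r(1)] mult.assoc)
    then have "norm (r * ?X) = 0" using z r(2) cs_cstar_identity[of "r * ?X"] by simp
    then have "(r * r) * ?X = 0" by (simp add: mult.assoc)
    then show ?thesis unfolding r(2) .
  qed
  then have "v * v * v * cu_emb a = 0" by (rule essential_ideal_unitization[OF J])
  moreover have "v * (v * (v * v)) = v * (v * (- (2 *\<^sub>R (v * cu_emb a))))" by (simp only: v(4))
  ultimately have "(v * v) * (v * v) = 0" by (simp add: mult.assoc)
  then have "norm (v * v) = 0"
    using norm_square_selfadj[of "v * v"] v(1) by (simp add: cs_cstar_mult)
  then have "v = 0" using norm_square_selfadj[OF v(1)] by simp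
  then show ?thesis using v(2) by (simp add: cs_positive_iff_cpos)
qed

text \<open>For \<open>r > s\<^sup>2\<close> the negative part of \<open>r - b\<^sup>*b\<close> annihilates \<open>J\<close>, hence vanishes.\<close>

lemma norm_le_by_compression:
  fixes b :: "'a::cstar_algebra"
  assumes J: "cstar_ideal J" "essential_ideal J"
    and le: "\<And>x. x \<in> J \<Longrightarrow> norm x \<le> 1 \<Longrightarrow> norm (b * x) \<le> s"
  shows "norm b \<le> s"
proof (rule field_le_epsilon)
  fix \<epsilon> :: real assume \<epsilon>: "0 < \<epsilon>"
  have s: "0 \<le> s" using le[of 0] J(1) by (simp add: cstar_ideal_def)
  have le': "norm (b * x) \<le> s * norm x" if x: "x \<in> J" for x
  proof (cases "x = 0")
    case False
    have "(1 / norm x) *\<^sub>R x \<in> J" using J(1) x unfolding cstar_ideal_def cs_scaleR_scaleC by blast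
    then show ?thesis using le[of "(1 / norm x) *\<^sub>R x"] False by (simp add: field_simps)
  qed simp
  define r where "r = (s + \<epsilon>)\<^sup>2"
  have r: "r > s\<^sup>2" using s \<epsilon> by (simp add: r_def power_strict_mono)
  then have r0: "r > 0" using zero_le_power2[of s] by linarith
  define B where "B = cu_emb b"
  define W where "W = r *\<^sub>R 1 - cstar B * B"
  have "cstar W = W"
    by (simp add: W_def cstar_diff cstar_scaleR cs_cstar_mult cs_cstar_cstar)
  then obtain v where v: "cstar v = v" "cpos (W + v)" "v * W = W * v"
    "v * v = - (2 *\<^sub>R (v * W))" "cpos (v * v * v)" by (rule abs_decomposition)
  have "v * (v * v) = v * (- (2 *\<^sub>R (v * W)))" by (simp only: v(4))
  then have "v * (W * v) = - ((1/2) *\<^sub>R (v * v * v))" by (simp add: v(3)[symmetric] mult.assoc)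
  moreover have "v * (cstar B * B) * v = r *\<^sub>R (v * v) - v * (W * v)" by (simp add: W_def algebra_simps)
  \<comment> \<open>On vJ the element b is therefore bounded below: norm (b v x)^2 \<ge> r norm (v
    x)^2. Since vx lies in \<open>J\<close> and r > s^2, the upper bound by s forces vx = 0.\<close>
  ultimately have vbv: "v * (cstar B * B) * v = r *\<^sub>R (v * v) + (1/2) *\<^sub>R (v * v * v)" by simp
  have vJ: "v * cu_emb x = 0" if x: "x \<in> J" for x
  proof -
    let ?X = "cu_emb x" and ?y = "cu_op v x"
    have y: "cu_emb ?y = v * ?X" by (simp only: mult_cu_emb)
    have eq: "cstar (B * (v * ?X)) * (B * (v * ?X))
        = r *\<^sub>R (cstar (v * ?X) * (v * ?X)) + (1/2) *\<^sub>R (cstar ?X * (v * v * v) * ?X)"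
    proof -
      have "cstar (B * (v * ?X)) * (B * (v * ?X)) = cstar ?X * (v * (cstar B * B) * v) * ?X"
        by (simp add: cs_cstar_mult v(1) mult.assoc)
      also have "\<dots> = r *\<^sub>R (cstar (v * ?X) * (v * ?X)) + (1/2) *\<^sub>R (cstar ?X * (v * v * v) * ?X)"
        unfolding vbv by (simp add: cs_cstar_mult v(1) algebra_simps)
      finally show ?thesis .
    qed
    have "norm (r *\<^sub>R (cstar (v * ?X) * (v * ?X))) \<le> norm (cstar (B * (v * ?X)) * (B * (v * ?X)))"
    proof (rule cpos_norm_mono)
      show "cpos (r *\<^sub>R (cstar (v * ?X) * (v * ?X)))" using r0 by (intro cpos_scaleR cpos_cstar_mult) simp
      have "cpos ((1/2) *\<^sub>R (cstar ?X * (v * v * v) * ?X))" by (intro cpos_scaleR cpos_conj v(5)) simp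
      then show "cpos (cstar (B * (v * ?X)) * (B * (v * ?X)) - r *\<^sub>R (cstar (v * ?X) * (v * ?X)))"
        unfolding eq by simp
    qed
    then have "r * (norm ?y)\<^sup>2 \<le> (norm (b * ?y))\<^sup>2"
      unfolding norm_scaleR cs_cstar_identity y[symmetric] B_def cu_emb_simps(3)[symmetric] norm_cu_emb
      using r0 by simp
    also have "\<dots> \<le> (s * norm ?y)\<^sup>2"
      using le'[OF cu_op_ideal[OF J(1) x]] by (intro power_mono) simp_all
    finally have "(r - s\<^sup>2) * (norm ?y)\<^sup>2 \<le> 0" by (simp add: power_mult_distrib algebra_simps)
    then have "(norm ?y)\<^sup>2 \<le> 0" using r by (simp add: mult_le_0_iff)
    then have "?y = 0" by (simp del: cu_op_apply)
    then show ?thesis unfolding y[symmetric] by (simp only: cu_emb_simps)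
  qed
  \<comment> \<open>Now vW = rv, so v^2 = -2rv and v^3 = -2r v^2. Both v^3 and v^2 are positive,
    which leaves v = 0 and W \<ge> 0.\<close>
  have "v * (cstar B * B) = 0"
    using essential_ideal_unitization[OF J vJ, of "cstar b * b"] by (simp add: B_def cu_emb_simps)
  then have "v * W = r *\<^sub>R v" by (simp add: W_def right_diff_distrib)
  then have "v * (v * v) = v * (- (2 *\<^sub>R (r *\<^sub>R v)))" by (simp only: v(4))
  then have "v * v * v = - ((2 * r) *\<^sub>R (v * v))" by (simp add: mult.assoc)
  then have "cpos ((1 / (2 * r)) *\<^sub>R (- ((2 * r) *\<^sub>R (v * v))))"
    using cpos_scaleR[OF v(5), of "1 / (2 * r)"] r0 by simp
  then have "cpos (- (v * v))" using r0 by simp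
  then have "v * v = 0" using cpos_antisym[OF cpos_square[OF v(1)]] by blast
  then have "v = 0" using norm_square_selfadj[OF v(1)] by simp
  then have "norm (cstar B * B) \<le> norm (r *\<^sub>R (1::'a cunit))"
    using v(2) by (intro cpos_norm_mono cpos_cstar_mult) (simp add: W_def)
  then have "(norm b)\<^sup>2 \<le> (s + \<epsilon>)\<^sup>2" using r0 by (simp add: cs_cstar_identity B_def r_def)
  then show "norm b \<le> s + \<epsilon>" using s \<epsilon> by (intro power2_le_imp_le[of "norm b"]) auto
qed

subsection \<open>Hilbert modules\<close>

locale hmod_over =
  fixes M :: "('m, 'a::cstar_algebra, 'b) hmod_scheme"
  assumes hilbert: "hilbert_module M"
begin

abbreviation C :: "'m set" where "C \<equiv> hcarrier M"

lemma
  shows zero_closed: "hzero M \<in> C"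
    and add_closed: "m \<in> C \<Longrightarrow> n \<in> C \<Longrightarrow> hadd M m n \<in> C"
    and scale_closed: "m \<in> C \<Longrightarrow> hscale M c m \<in> C"
    and act_closed: "m \<in> C \<Longrightarrow> hact M m a \<in> C"
    and add_minus: "m \<in> C \<Longrightarrow> hadd M m (hscale M (-1) m) = hzero M"
    and hip_add: "m \<in> C \<Longrightarrow> n \<in> C \<Longrightarrow> k \<in> C \<Longrightarrow> hip M m (hadd M n k) = hip M m n + hip M m k"
    and hip_scale: "m \<in> C \<Longrightarrow> n \<in> C \<Longrightarrow> hip M m (hscale M c n) = scaleC c (hip M m n)"
    and hip_act: "m \<in> C \<Longrightarrow> n \<in> C \<Longrightarrow> hip M m (hact M n a) = hip M m n * a"
    and hip_cstar: "m \<in> C \<Longrightarrow> n \<in> C \<Longrightarrow> cstar (hip M m n) = hip M n m"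
    and hip_positive: "m \<in> C \<Longrightarrow> cs_positive (hip M m m)"
    and hip_definite: "m \<in> C \<Longrightarrow> hip M m m = 0 \<Longrightarrow> m = hzero M"
  using hilbert by (simp_all add: hilbert_module_def Let_def)

lemmas add_assoc = hilbert[unfolded hilbert_module_def Let_def, THEN conjunct2, THEN conjunct2, THEN conjunct2, THEN conjunct2, THEN conjunct1, rule_format]
lemmas add_commute = hilbert[unfolded hilbert_module_def Let_def, THEN conjunct2, THEN conjunct2, THEN conjunct2, THEN conjunct2, THEN conjunct2,
  THEN conjunct1, rule_format]
lemmas zero_add = hilbert[unfolded hilbert_module_def Let_def, THEN conjunct2, THEN conjunct2, THEN conjunct2, THEN conjunct2, THEN conjunct2, THEN conjunct2,
  THEN conjunct1, rule_format]

lemma complete: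
  "(\<And>k. s k \<in> C) \<Longrightarrow> (\<And>e. e > 0 \<Longrightarrow> \<exists>N. \<forall>p\<ge>N. \<forall>q\<ge>N. hdist M (s p) (s q) < e)
          \<Longrightarrow> \<exists>m\<in>C. (\<lambda>k. hdist M (s k) m) \<longlonglongrightarrow> 0"
  using hilbert[unfolded hilbert_module_def Let_def, THEN conjunct2, THEN conjunct2, THEN conjunct2, THEN conjunct2, THEN conjunct2, 
    THEN conjunct2, THEN conjunct2, THEN conjunct2, THEN conjunct2, THEN conjunct2, THEN conjunct2, 
    THEN conjunct2, THEN conjunct2, THEN conjunct2, THEN conjunct2, THEN conjunct2, THEN conjunct2, 
    THEN conjunct2, THEN conjunct2, THEN conjunct2, THEN conjunct2, THEN conjunct2, THEN conjunct2,
    THEN spec[of _ s]] by blast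

lemma hip_add_left: "m \<in> C \<Longrightarrow> n \<in> C \<Longrightarrow> k \<in> C \<Longrightarrow> hip M (hadd M m n) k = hip M m k + hip M n k"
  using hip_cstar[of k "hadd M m n"] hip_cstar[of k m] hip_cstar[of k n]
  by (simp add: add_closed hip_add cs_cstar_add)

lemma hip_act_left: "m \<in> C \<Longrightarrow> k \<in> C \<Longrightarrow> hip M (hact M m a) k = cstar a * hip M m k"
  using hip_cstar[of k "hact M m a"] hip_cstar[of k m] by (simp add: act_closed hip_act cs_cstar_mult)

abbreviation hsub :: "'m \<Rightarrow> 'm \<Rightarrow> 'm" where
  "hsub m n \<equiv> hadd M m (hscale M (-1) n)"

lemma sub_closed: "m \<in> C \<Longrightarrow> n \<in> C \<Longrightarrow> hsub m n \<in> C"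
  by (intro add_closed scale_closed)

lemma hip_sub: "m \<in> C \<Longrightarrow> n \<in> C \<Longrightarrow> k \<in> C \<Longrightarrow> hip M k (hsub m n) = hip M k m - hip M k n"
  by (simp add: hip_add hip_scale scale_closed scaleC_minus_left cs_scaleC_one)

lemma hip_sub_left: "m \<in> C \<Longrightarrow> n \<in> C \<Longrightarrow> k \<in> C \<Longrightarrow> hip M (hsub m n) k = hip M m k - hip M n k"
  using hip_cstar[of k "hsub m n"] hip_cstar[of k m] hip_cstar[of k n]
  by (simp only: sub_closed hip_sub cstar_diff)

lemma hip_zero: "m \<in> C \<Longrightarrow> hip M m (hzero M) = 0" "m \<in> C \<Longrightarrow> hip M (hzero M) m = 0"
proof -
  assume m: "m \<in> C"
  show z: "hip M m (hzero M) = 0"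
    using hip_add[OF m zero_closed zero_closed] zero_add[OF zero_closed] by simp
  show "hip M (hzero M) m = 0" using hip_cstar[OF m zero_closed] z by simp
qed

text \<open>Nondegeneracy of the inner product, which turns identities in the module into
  computations in \<open>A\<close>.\<close>

lemma hip_eqI:
  assumes m: "m \<in> C" and n: "n \<in> C" and eq: "\<And>k. k \<in> C \<Longrightarrow> hip M k m = hip M k n"
  shows "m = n"
proof -
  have "hip M (hsub m n) (hsub m n) = 0" using hip_sub[OF m n] eq sub_closed[OF m n] by simp
  then have z: "hsub m n = hzero M" using hip_definite sub_closed[OF m n] by blast
  have mn: "hscale M (-1) n \<in> C" using n by (rule scale_closed)
  have "m = hadd M m (hadd M n (hscale M (-1) n))"
    using add_minus[OF n] zero_add[OF m] add_commute[OF m zero_closed] by simp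
  also have "\<dots> = hadd M (hsub m n) n" using add_assoc[OF m mn n] add_commute[OF mn n] by simp
  finally show "m = n" using z zero_add[OF n] by simp
qed

lemma hnorm_nonneg: "0 \<le> hnorm M m" by (simp add: hnorm_def)

lemma hnorm_power2: "(hnorm M m)\<^sup>2 = norm (hip M m m)" by (simp add: hnorm_def)

text \<open>A factor \<open>b\<close> of <m,m> stands in for m: norms of mx and of m - mx become
  norms in \<open>A\<close>, where the approximate unit is available.\<close>

lemma hnorm_act_repr:
  assumes m: "m \<in> C"
  obtains b where "hip M m m = cstar b * b" "hnorm M m = norm b" "\<And>x. hnorm M (hact M m x) = norm (b * x)"
    "\<And>x. hdist M m (hact M m x) = norm (b - b * x)"
proof -
  obtain b where b: "hip M m m = cstar b * b" using hip_positive[OF m] by (auto simp: cs_positive_def)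
  have "hip M (hact M m x) (hact M m x) = cstar (b * x) * (b * x)" for x
    using m by (simp add: hip_act hip_act_left act_closed b cs_cstar_mult mult.assoc)
  moreover have "hip M (hsub m (hact M m x)) (hsub m (hact M m x)) = cstar (b - b * x) * (b - b * x)" for x
    using m by (simp add: hip_sub hip_sub_left hip_act hip_act_left act_closed sub_closed b cs_cstar_mult
        cstar_diff algebra_simps)
  ultimately show ?thesis using that[of b] b by (simp add: hnorm_def hdist_def cs_cstar_identity)
qed

lemma hnorm_act_le: "m \<in> C \<Longrightarrow> hnorm M (hact M m x) \<le> hnorm M m * norm x"
proof -
  assume m: "m \<in> C"
  obtain b where "hip M m m = cstar b * b" "hnorm M m = norm b" "\<And>x. hnorm M (hact M m x) = norm (b * x)"
    "\<And>x. hdist M m (hact M m x) = norm (b - b * x)" using hnorm_act_repr[OF m] by metis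
  then show ?thesis using norm_mult_ineq[of b x] by simp
qed

text \<open>Expand <z,z> \<ge> 0 for z = mc - Hn. Adding \<open>cstar c\<close> (H - h) c, positive
  because H is the norm of h, leaves H^2 k - H \<open>cstar c\<close> c \<ge> 0, and the norm is
  monotone on positive elements.\<close>

lemma cauchy_schwarz:
  assumes m: "m \<in> C" and n: "n \<in> C"
  shows "norm (hip M m n) \<le> hnorm M m * hnorm M n"
proof -
  define h c k H where "h = hip M m m" and "c = hip M m n" and "k = hip M n n" and "H = norm h"
  have cs: "hip M n m = cstar c" using hip_cstar[OF m n] by (simp add: c_def)
  show ?thesis
  proof (cases "H = 0")
    case True
    then have "m = hzero M" using hip_definite[OF m] by (simp add: H_def h_def)
    then show ?thesis using hip_zero n hnorm_nonneg by simp
  next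
    case False
    then have H: "H > 0" by (simp add: H_def)
    define z where "z = hsub (hact M m c) (hscale M (complex_of_real H) n)"
    have zC: "hact M m c \<in> C" "hscale M (complex_of_real H) n \<in> C" "z \<in> C"
      using m n by (simp_all add: z_def sub_closed act_closed scale_closed)
    have zl: "hip M z l = cstar (hip M l z)" if "l \<in> C" for l using hip_cstar[OF that zC(3)] by simp
    have zr: "hip M l z = hip M l m * c - H *\<^sub>R hip M l n" if "l \<in> C" for l
      using that m n zC by (simp add: z_def hip_sub hip_act hip_scale cs_scaleR_scaleC)
    have sh: "cstar h = h" using hip_cstar[OF m m] by (simp add: h_def)
    have "hip M z z = hip M z m * c - H *\<^sub>R hip M z n" using zr zC by blast
    also have "\<dots> = cstar (h * c - H *\<^sub>R c) * c - H *\<^sub>R cstar (cstar c * c - H *\<^sub>R k)"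
      using m n zl zr by (simp add: h_def c_def k_def hip_cstar)
    also have "\<dots> = H\<^sup>2 *\<^sub>R k - H *\<^sub>R (cstar c * c) - (H *\<^sub>R (cstar c * c) - cstar c * h * c)"
      using hip_cstar[OF n n]
      by (simp add: cstar_diff cstar_scaleR cs_cstar_mult cs_cstar_cstar sh k_def algebra_simps power2_eq_square)
    finally have zz: "hip M z z = H\<^sup>2 *\<^sub>R k - H *\<^sub>R (cstar c * c) - (H *\<^sub>R (cstar c * c) - cstar c * h * c)" .
    have "cstar (cu_emb h) = cu_emb h" by (metis cu_emb_simps(4) sh)
    then have "cpos (cstar (cu_emb c) * (H *\<^sub>R 1 - cu_emb h) * cu_emb c)"
      by (intro cpos_conj cpos_norm_diff) (simp_all add: H_def)
    then have p: "cpos (cu_emb (H *\<^sub>R (cstar c * c) - cstar c * h * c))"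
      by (simp add: cu_emb_simps algebra_simps)
    have "cpos (cu_emb (hip M z z))" using hip_positive[OF zC(3)] by (simp add: cs_positive_iff_cpos)
    from cpos_add[OF this p] have "cs_positive (H\<^sup>2 *\<^sub>R k - H *\<^sub>R (cstar c * c))"
      unfolding cs_positive_iff_cpos zz cu_emb_simps by (simp only: diff_add_cancel)
    moreover have "cs_positive (H *\<^sub>R (cstar c * c))"
      unfolding cs_positive_iff_cpos cu_emb_simps using H by (intro cpos_scaleR cpos_cstar_mult) simp
    ultimately have "norm (H *\<^sub>R (cstar c * c)) \<le> norm (H\<^sup>2 *\<^sub>R k)" by (rule cs_positive_norm_mono[rotated])
    then have "H * (norm c)\<^sup>2 \<le> H * (H * norm k)" using H by (simp add: cs_cstar_identity power2_eq_square)
    then have "(norm c)\<^sup>2 \<le> H * norm k" using H by simp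
    also have "\<dots> = (hnorm M m * hnorm M n)\<^sup>2"
      by (simp add: power_mult_distrib hnorm_power2 H_def h_def k_def)
    finally show ?thesis unfolding c_def
      by (rule power2_le_imp_le) (simp add: hnorm_nonneg)
  qed
qed

lemma norm_hip_diff_le:
  "l \<in> C \<Longrightarrow> m \<in> C \<Longrightarrow> n \<in> C \<Longrightarrow> norm (hip M l m - hip M l n) \<le> hnorm M l * hdist M m n"
  using cauchy_schwarz[of l "hsub m n"] by (simp add: hip_sub sub_closed hdist_def)

text \<open>If f multiplied by e_k is represented by n_k, and convergence of b e_k makes n_k Cauchy,
  the limit represents f. This produces adjoints on \<open>M\<^sub>J\<close> and elements of M from
  elements of \<open>M\<^sup>J\<close>.\<close>

lemma functional_limit:
  assumes n: "\<And>k. n k \<in> C" "\<And>m k. m \<in> C \<Longrightarrow> hip M m (n k) = f m * e k"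
    and f: "\<And>m. m \<in> C \<Longrightarrow> (\<lambda>k. f m * e k) \<longlonglongrightarrow> f m"
    and c: "\<And>k l. hdist M (n k) (n l) \<le> K * norm (b * e k - b * e l)" "(\<lambda>k. b * e k) \<longlonglongrightarrow> b"
  obtains l where "l \<in> C" "\<And>m. m \<in> C \<Longrightarrow> hip M m l = f m"
proof -
  have "\<exists>l\<in>C. (\<lambda>k. hdist M (n k) l) \<longlonglongrightarrow> 0"
  proof (rule complete)
    fix \<epsilon> :: real assume \<epsilon>: "\<epsilon> > 0"
    \<comment> \<open>The sign of \<open>K\<close> is not known, hence the divisor
      \<open>\<bar>K\<bar> + 1\<close>.\<close>
    obtain N where N: "\<And>p q. p \<ge> N \<Longrightarrow> q \<ge> N \<Longrightarrow> norm (b * e p - b * e q) < \<epsilon> / (\<bar>K\<bar> + 1)"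
      using CauchyD[OF LIMSEQ_imp_Cauchy[OF c(2)], of "\<epsilon> / (\<bar>K\<bar> + 1)"] \<epsilon> by auto
    have "hdist M (n p) (n q) < \<epsilon>" if "p \<ge> N" "q \<ge> N" for p q
    proof -
      have "hdist M (n p) (n q) \<le> (\<bar>K\<bar> + 1) * norm (b * e p - b * e q)"
        by (rule order_trans[OF c(1)]) (simp add: mult_right_mono)
      also have "\<dots> < (\<bar>K\<bar> + 1) * (\<epsilon> / (\<bar>K\<bar> + 1))" using N[OF that] by (intro mult_strict_left_mono) auto
      finally show ?thesis by (simp add: add_nonneg_eq_0_iff)
    qed
    then show "\<exists>N. \<forall>p\<ge>N. \<forall>q\<ge>N. hdist M (n p) (n q) < \<epsilon>" by blast
  qed (rule n)
  then obtain l where l: "l \<in> C" "(\<lambda>k. hdist M (n k) l) \<longlonglongrightarrow> 0" by blast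
  have "hip M m l = f m" if m: "m \<in> C" for m
  proof -
    have "(\<lambda>k. hip M m (n k) - hip M m l) \<longlonglongrightarrow> 0"
      by (rule Lim_null_comparison[OF _ tendsto_mult_right_zero[OF l(2), of "hnorm M m"]])
        (intro always_eventually allI norm_hip_diff_le m n l)
    then have "(\<lambda>k. f m * e k) \<longlonglongrightarrow> hip M m l" using n(2)[OF m] LIM_zero_cancel by force
    then show ?thesis using f[OF m] LIMSEQ_unique by blast
  qed
  then show ?thesis using that l by blast
qed

lemma mhat_inject: "m \<in> C \<Longrightarrow> n \<in> C \<Longrightarrow> mhat M m = mhat M n \<Longrightarrow> m = n"
  by (rule hip_eqI) (auto simp: mhat_def fun_eq_iff split: if_splits)

lemma elem_mhat: "n \<in> C \<Longrightarrow> elem M (mhat M n) = n"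
  unfolding elem_def by (rule the_equality) (auto dest: mhat_inject)

lemma mhat_elem: "f \<in> mhat M ` C \<Longrightarrow> elem M f \<in> C \<and> mhat M (elem M f) = f"
  using elem_mhat by auto

lemma mhat_apply: "m \<in> C \<Longrightarrow> mhat M n m = hip M m n" by (simp add: mhat_def)

end

section \<open>The submodule \<open>M\<^sub>J\<close>\<close>

locale hmod_essential = hmod_over M for M :: "('m, 'a::cstar_algebra, 'b) hmod_scheme" +
  fixes J :: "'a set"
  assumes ideal: "cstar_ideal J" and essential: "essential_ideal J"
begin

lemma J_mult: "x \<in> J \<Longrightarrow> a * x \<in> J" "x \<in> J \<Longrightarrow> x * a \<in> J"
  and J_closed: "closed J"
  and J_zero: "0 \<in> J"
  and J_add: "x \<in> J \<Longrightarrow> y \<in> J \<Longrightarrow> x + y \<in> J"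
  using ideal by (auto simp: cstar_ideal_def)

lemma J_diff: "x \<in> J \<Longrightarrow> y \<in> J \<Longrightarrow> x - y \<in> J"
proof -
  assume "x \<in> J" "y \<in> J"
  then have "x + scaleC (-1) y \<in> J" using ideal by (auto simp: cstar_ideal_def)
  then show ?thesis by (simp add: scaleC_minus_left cs_scaleC_one)
qed

lemma J_cstar: "x \<in> J \<Longrightarrow> cstar x \<in> J" by (rule ideal_cstar[OF ideal])

lemma J_limit: "(\<And>k::nat. s k \<in> J) \<Longrightarrow> s \<longlonglongrightarrow> l \<Longrightarrow> l \<in> J"
  using closed_sequentially[OF J_closed] by blast

lemma essential_eq: "(\<And>x. x \<in> J \<Longrightarrow> a * x = b * x) \<Longrightarrow> a = b"
  using essential[unfolded essential_ideal_def, rule_format, of "a - b"] by (simp add: left_diff_distrib)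

lemma MJalg_hip: "u \<in> MJalg M J \<Longrightarrow> u \<in> C \<and> (\<forall>n\<in>C. hip M n u \<in> J)"
  by (induction rule: MJalg.induct)
    (auto simp: zero_closed act_closed add_closed hip_zero hip_act hip_add J_zero J_mult J_add)

lemma MsubJ_approx:
  assumes m: "m \<in> C" and J: "hip M m m \<in> J"
  obtains e b where "\<And>k. e k \<in> J" "(\<lambda>k. b * e k) \<longlonglongrightarrow> b" "hip M m m = cstar b * b"
    "\<And>x. hnorm M (hact M m x) = norm (b * x)" "\<And>x. hdist M m (hact M m x) = norm (b - b * x)"
    "\<And>k. cstar (e k) = e k"
proof -
  obtain b where b: "hip M m m = cstar b * b" "\<And>x. hnorm M (hact M m x) = norm (b * x)"
    "\<And>x. hdist M m (hact M m x) = norm (b - b * x)" using hnorm_act_repr[OF m] by metis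
  obtain e where "\<And>k. e k \<in> J" "\<And>k. cstar (e k) = e k" "(\<lambda>k. b * e k) \<longlonglongrightarrow> b"
    using ideal_approximate_unit[OF ideal] J b(1) by metis
  then show ?thesis using that b by blast
qed

text \<open>For u in the algebraic span, <m,u> lies in the closed set \<open>J\<close> and
  approximates <m,m>. Conversely, m e_k tends to m for the approximate unit built from
  <m,m>.\<close>

lemma MsubJ_iff: "m \<in> MsubJ M J \<longleftrightarrow> m \<in> C \<and> hip M m m \<in> J"
proof
  assume m: "m \<in> MsubJ M J"
  then have mC: "m \<in> C" by (simp add: MsubJ_def)
  have "hip M m m \<in> closure J"
    unfolding closure_approachable
  proof (intro allI impI)
    fix e :: real assume e: "e > 0"
    then have "e / (hnorm M m + 1) > 0" using hnorm_nonneg[of m] by (simp add: add_nonneg_pos)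
    then obtain u where u: "u \<in> MJalg M J" "hdist M m u < e / (hnorm M m + 1)"
      using m unfolding MsubJ_def by blast
    have uC: "u \<in> C" "hip M m u \<in> J" using MJalg_hip[OF u(1)] mC by auto
    have "norm (hip M m m - hip M m u) \<le> hnorm M m * hdist M m u" by (rule norm_hip_diff_le[OF mC mC uC(1)])
    also have "\<dots> \<le> (hnorm M m + 1) * hdist M m u"
      by (intro mult_right_mono) (simp_all add: hdist_def hnorm_def)
    also have "\<dots> < e" using u(2) hnorm_nonneg[of m] by (simp add: field_simps add_nonneg_pos)
    finally have "dist (hip M m u) (hip M m m) < e" by (simp add: dist_norm norm_minus_commute)
    then show "\<exists>y\<in>J. dist y (hip M m m) < e" using uC by blast
  qed
  then show "m \<in> C \<and> hip M m m \<in> J" using mC J_closed by simp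
next
  assume m: "m \<in> C \<and> hip M m m \<in> J"
  then obtain e b where e: "\<And>k. e k \<in> J" "(\<lambda>k. b * e k) \<longlonglongrightarrow> b"
    "\<And>x. hdist M m (hact M m x) = norm (b - b * x)" using MsubJ_approx by metis
  have "\<exists>u\<in>MJalg M J. hdist M m u < \<epsilon>" if "\<epsilon> > 0" for \<epsilon>
  proof -
    obtain k where "norm (b * e k - b) < \<epsilon>" using LIMSEQ_D[OF e(2) \<open>\<epsilon> > 0\<close>] by blast
    then have "hdist M m (hact M m (e k)) < \<epsilon>" by (simp add: e(3) norm_minus_commute)
    then show ?thesis using MJ_gen[of m M "e k" J] m e(1) by blast
  qed
  then show "m \<in> MsubJ M J" using m by (simp add: MsubJ_def)
qed

lemma MsubJ_hip:
  assumes m: "m \<in> MsubJ M J" and n: "n \<in> C"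
  shows "hip M n m \<in> J" "hip M m n \<in> J"
proof -
  have mC: "m \<in> C" "hip M m m \<in> J" using m by (auto simp: MsubJ_iff)
  obtain e b where e: "\<And>k. e k \<in> J" "(\<lambda>k. b * e k) \<longlonglongrightarrow> b"
    "\<And>x. hdist M m (hact M m x) = norm (b - b * x)" using MsubJ_approx[OF mC] by metis
  have "(\<lambda>k. hip M n m - hip M n m * e k) \<longlonglongrightarrow> 0"
  proof (rule Lim_null_comparison)
    show "\<forall>\<^sub>F k in sequentially. norm (hip M n m - hip M n m * e k) \<le> hnorm M n * norm (b - b * e k)"
      using norm_hip_diff_le[OF n mC(1) act_closed[OF mC(1)]] by (simp add: hip_act n mC(1) e(3))
    show "(\<lambda>k. hnorm M n * norm (b - b * e k)) \<longlonglongrightarrow> 0"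
      using tendsto_mult_right_zero[OF tendsto_norm_zero[OF tendsto_diff[OF tendsto_const[of b] e(2), simplified]]] .
  qed
  from tendsto_diff[OF tendsto_const[of "hip M n m"] this] have "(\<lambda>k. hip M n m * e k) \<longlonglongrightarrow> hip M n m" by simp
  then show "hip M n m \<in> J" by (rule J_limit[rotated]) (intro J_mult e)
  then show "hip M m n \<in> J" using J_cstar hip_cstar[OF n mC(1)] by metis
qed

lemma MsubJ_iff': "m \<in> MsubJ M J \<longleftrightarrow> m \<in> C \<and> (\<forall>n\<in>C. hip M n m \<in> J)"
proof
  assume m: "m \<in> MsubJ M J"
  then show "m \<in> C \<and> (\<forall>n\<in>C. hip M n m \<in> J)" using MsubJ_hip(1)[OF m] by (simp add: MsubJ_iff)
qed (simp add: MsubJ_iff)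

lemma act_MsubJ: "m \<in> C \<Longrightarrow> x \<in> J \<Longrightarrow> hact M m x \<in> MsubJ M J"
  by (simp add: MsubJ_iff' act_closed hip_act J_mult)

text \<open>Reduces norms on M to norms on \<open>M\<^sub>J\<close>, where mx lies; this is what
  makes restriction isometric.\<close>

lemma hnorm_le_by_compression:
  assumes m: "m \<in> C" and le: "\<And>x. x \<in> J \<Longrightarrow> norm x \<le> 1 \<Longrightarrow> hnorm M (hact M m x) \<le> s"
  shows "hnorm M m \<le> s"
proof -
  obtain b where b: "hip M m m = cstar b * b" "hnorm M m = norm b" "\<And>x. hnorm M (hact M m x) = norm (b * x)"
    "\<And>x. hdist M m (hact M m x) = norm (b - b * x)" using hnorm_act_repr[OF m] by metis
  have "norm (b * x) \<le> s" if "x \<in> J" "norm x \<le> 1" for x using le[OF that] by (simp only: b(3))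
  then show ?thesis unfolding b(2) by (rule norm_le_by_compression[OF ideal essential])
qed

lemma MsubJ_mod_simps [simp]:
  "hcarrier (MsubJ_mod M J) = MsubJ M J" "hip (MsubJ_mod M J) = hip M"
  "hadd (MsubJ_mod M J) = hadd M" "hscale (MsubJ_mod M J) = hscale M"
  "hnorm (MsubJ_mod M J) = hnorm M"
  by (auto simp: MsubJ_mod_def hnorm_def fun_eq_iff)

end

text \<open>Stated through upper bounds so that it also covers unbounded sets, where \<open>Sup\<close> is an
  unspecified value: no bound on adjointable operators of \<open>M\<^sup>J\<close> is needed.\<close>

lemma Sup_real_cong:
  fixes X Y :: "real set"
  assumes "\<And>K. (\<forall>x\<in>X. x \<le> K) \<longleftrightarrow> (\<forall>y\<in>Y. y \<le> K)"
  shows "Sup X = Sup Y"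
  unfolding Sup_real_def assms ..

lemma image_unit_ball_bounded_iff:
  "(\<forall>x\<in>(\<lambda>m. hnorm L (T m)) ` {m \<in> hcarrier L. hnorm L m \<le> 1}. x \<le> K)
     \<longleftrightarrow> (\<forall>m\<in>hcarrier L. hnorm L m \<le> 1 \<longrightarrow> hnorm L (T m) \<le> K)"
  by auto

lemma opnorm_cong:
  assumes "\<And>K. (\<forall>m\<in>hcarrier L. hnorm L m \<le> 1 \<longrightarrow> hnorm L (T m) \<le> K)
     \<longleftrightarrow> (\<forall>m\<in>hcarrier L'. hnorm L' m \<le> 1 \<longrightarrow> hnorm L' (S m) \<le> K)"
  shows "opnorm L T = opnorm L' S"
  unfolding opnorm_def by (rule Sup_real_cong) (simp only: image_unit_ball_bounded_iff assms)

section \<open>Restriction of \<open>J\<close>-adjointable operators\<close>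

context hmod_essential
begin

context
  fixes T assumes T: "T \<in> BJ M J"
begin

lemma BJ_closed: "m \<in> C \<Longrightarrow> T m \<in> C"
  and BJ_add: "m \<in> C \<Longrightarrow> n \<in> C \<Longrightarrow> T (hadd M m n) = hadd M (T m) (T n)"
  and BJ_scale: "m \<in> C \<Longrightarrow> T (hscale M c m) = hscale M c (T m)"
  and BJ_act: "m \<in> C \<Longrightarrow> T (hact M m a) = hact M (T m) a"
  using T by (auto simp: BJ_def bounded_Alin_def)

lemma BJ_bound: "\<exists>K. \<forall>m\<in>C. hnorm M (T m) \<le> K * hnorm M m"
  using T by (simp add: BJ_def bounded_Alin_def)

text \<open>By boundedness T(m e_k) = T(m) e_k tends to T m, so <n, T m> is a limit of elements of
  \<open>J\<close>.\<close>

lemma BJ_MsubJ: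
  assumes m: "m \<in> MsubJ M J"
  shows "T m \<in> MsubJ M J"
proof -
  have mC: "m \<in> C" "hip M m m \<in> J" using m by (auto simp: MsubJ_iff)
  obtain e b where e: "\<And>k. e k \<in> J" "(\<lambda>k. b * e k) \<longlonglongrightarrow> b"
    "\<And>x. hdist M m (hact M m x) = norm (b - b * x)" using MsubJ_approx[OF mC] by metis
  obtain K where K: "\<And>m. m \<in> C \<Longrightarrow> hnorm M (T m) \<le> K * hnorm M m" using BJ_bound by blast
  have "hip M n (T m) \<in> J" if n: "n \<in> C" for n
  proof -
    have b0: "(\<lambda>k. hnorm M n * (K * norm (b - b * e k))) \<longlonglongrightarrow> 0"
      using tendsto_norm_zero[OF tendsto_diff[OF tendsto_const[of b] e(2), simplified]]
      by (intro tendsto_mult_right_zero)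
    have "(\<lambda>k. hip M n (T m) - hip M n (T m) * e k) \<longlonglongrightarrow> 0"
    proof (rule Lim_null_comparison[OF always_eventually b0], rule allI)
      fix k
      have eq: "hsub (T m) (hact M (T m) (e k)) = T (hsub m (hact M m (e k)))"
        using mC(1) by (simp add: BJ_add BJ_scale BJ_act act_closed scale_closed)
      have "norm (hip M n (T m) - hip M n (T m) * e k) \<le> hnorm M n * hdist M (T m) (hact M (T m) (e k))"
        using norm_hip_diff_le[OF n BJ_closed[OF mC(1)] act_closed[OF BJ_closed[OF mC(1)]]]
        by (simp add: hip_act n BJ_closed mC(1))
      also have "\<dots> \<le> hnorm M n * (K * norm (b - b * e k))"
        unfolding hdist_def eq e(3)[symmetric]
        using mC(1) by (intro mult_left_mono K hnorm_nonneg sub_closed act_closed)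
      finally show "norm (hip M n (T m) - hip M n (T m) * e k) \<le> hnorm M n * (K * norm (b - b * e k))" .
    qed
    from tendsto_diff[OF tendsto_const[of "hip M n (T m)"] this]
    have "(\<lambda>k. hip M n (T m) * e k) \<longlonglongrightarrow> hip M n (T m)" by simp
    then show ?thesis by (rule J_limit[rotated]) (intro J_mult e)
  qed
  then show ?thesis using mC BJ_closed by (simp add: MsubJ_iff')
qed

text \<open>\<open>J\<close>-adjointability represents m \<mapsto> <Tm,u> e_k by some n_k. For d =
  n_k - n_l one has <d,d> = <Td, u(e_k - e_l)>, so Cauchy-Schwarz makes n_k a Cauchy sequence; its
  limit is the adjoint at u.\<close>

lemma BJ_adjoint:
  assumes u: "u \<in> MsubJ M J"
  obtains l where "l \<in> MsubJ M J" "\<And>m. m \<in> C \<Longrightarrow> hip M m l = hip M (T m) u"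
proof -
  have uC: "u \<in> C" "hip M u u \<in> J" using u by (auto simp: MsubJ_iff)
  obtain e b where e: "\<And>k. e k \<in> J" "(\<lambda>k. b * e k) \<longlonglongrightarrow> b"
    "\<And>x. hnorm M (hact M u x) = norm (b * x)"
    "\<And>x. hdist M u (hact M u x) = norm (b - b * x)" using MsubJ_approx[OF uC] by metis
  obtain K where K: "\<And>m. m \<in> C \<Longrightarrow> hnorm M (T m) \<le> K * hnorm M m" using BJ_bound by blast
  have "\<forall>k. \<exists>n. n \<in> C \<and> (\<forall>m\<in>C. hip M m n = hip M (T m) u * e k)"
  proof
    fix k
    have "fact (Tstar M T (mhat M u)) (e k) \<in> mhat M ` C" using T uC e(1) by (simp add: BJ_def)
    then obtain n where n: "n \<in> C" "fact (Tstar M T (mhat M u)) (e k) = mhat M n" by auto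
    have "hip M m n = hip M (T m) u * e k" if "m \<in> C" for m
      using fun_cong[OF n(2), of m] that by (simp add: fact_def Tstar_def mhat_def BJ_closed)
    then show "\<exists>n. n \<in> C \<and> (\<forall>m\<in>C. hip M m n = hip M (T m) u * e k)" using n by blast
  qed
  then obtain n where n: "\<And>k. n k \<in> C" "\<And>m k. m \<in> C \<Longrightarrow> hip M m (n k) = hip M (T m) u * e k" by metis
  have lim: "(\<lambda>k. hip M (T m) u * e k) \<longlonglongrightarrow> hip M (T m) u" if m: "m \<in> C" for m
  proof -
    have b0: "(\<lambda>k. hnorm M (T m) * norm (b - b * e k)) \<longlonglongrightarrow> 0"
      using tendsto_norm_zero[OF tendsto_diff[OF tendsto_const[of b] e(2), simplified]]
      by (intro tendsto_mult_right_zero)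
    have "(\<lambda>k. hip M (T m) u - hip M (T m) u * e k) \<longlonglongrightarrow> 0"
      by (rule Lim_null_comparison[OF _ b0])
        (use norm_hip_diff_le[OF BJ_closed[OF m] uC(1) act_closed[OF uC(1)]] in
          \<open>simp add: hip_act BJ_closed m uC(1) e(4)\<close>)
    from tendsto_diff[OF tendsto_const[of "hip M (T m) u"] this] show ?thesis by simp
  qed
  \<comment> \<open>For distance zero only the sign of the right side matters: K \<ge> 0 if u is
    nonzero, and otherwise b e_k = 0. For nonzero distance a factor norm d can be cancelled.\<close>
  have dist: "hdist M (n k) (n l) \<le> K * norm (b * e k - b * e l)" for k l
  proof (cases "hdist M (n k) (n l) = 0")
    case True
    have "hnorm M (T u) \<le> K * hnorm M u" using K uC by blast
    show ?thesis
    proof (cases "hnorm M u = 0")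
      case True
      then have "hip M u u = 0" by (simp add: hnorm_def)
      then have "norm (b * e k) = 0" for k using e(3)[of "e k"] hnorm_act_le[OF uC(1), of "e k"] True by simp
      then show ?thesis using \<open>hdist M (n k) (n l) = 0\<close> by simp
    next
      case False
      have "0 \<le> K * hnorm M u" using \<open>hnorm M (T u) \<le> K * hnorm M u\<close> hnorm_nonneg order_trans by blast
      then have "0 \<le> K" using False hnorm_nonneg[of u] by (simp add: zero_le_mult_iff)
      then show ?thesis using \<open>hdist M (n k) (n l) = 0\<close> by simp
    qed
  next
    case False
    define d where "d = hsub (n k) (n l)"
    have d: "d \<in> C" "hnorm M d = hdist M (n k) (n l)" using n by (simp_all add: d_def sub_closed hdist_def)
    have "hip M d d = hip M (T d) u * e k - hip M (T d) u * e l"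
      by (subst (2) d_def) (simp add: hip_sub n d(1))
    also have "\<dots> = hip M (T d) (hact M u (e k - e l))"
      using uC BJ_closed[OF d(1)] by (simp add: hip_act algebra_simps)
    finally have "(hnorm M d)\<^sup>2 = norm (hip M (T d) (hact M u (e k - e l)))" by (simp add: hnorm_power2)
    also have "\<dots> \<le> hnorm M (T d) * norm (b * e k - b * e l)"
      using cauchy_schwarz[OF BJ_closed[OF d(1)] act_closed[OF uC(1)], of "e k - e l"]
      by (simp add: e(3) algebra_simps)
    also have "\<dots> \<le> K * hnorm M d * norm (b * e k - b * e l)" using K[OF d(1)] by (intro mult_right_mono) auto
    finally have "hnorm M d * hnorm M d \<le> hnorm M d * (K * norm (b * e k - b * e l))"
      by (simp add: power2_eq_square mult.commute mult.left_commute)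
    then show ?thesis using False d(2) hnorm_nonneg[of d] by (simp add: mult_le_cancel_left)
  qed
  obtain l where l: "l \<in> C" "\<And>m. m \<in> C \<Longrightarrow> hip M m l = hip M (T m) u"
    using functional_limit[OF n lim dist e(2)] by blast
  then have "l \<in> MsubJ M J" using MsubJ_hip(1)[OF u] BJ_closed by (simp add: MsubJ_iff')
  then show ?thesis using that l by blast
qed

end

lemma ualpha_isometric: "isometric_injective_hom M (MsubJ_mod M J) (BJ M J) (ualpha M J)"
  unfolding isometric_injective_hom_def
proof (intro conjI ballI allI impI)
  fix T assume T: "T \<in> BJ M J"
  have "\<forall>u\<in>MsubJ M J. \<exists>l\<in>MsubJ M J. \<forall>m\<in>C. hip M m l = hip M (T m) u" using BJ_adjoint[OF T] by metis
  then obtain S where S: "\<And>u. u \<in> MsubJ M J \<Longrightarrow> S u \<in> MsubJ M J"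
    "\<And>u m. u \<in> MsubJ M J \<Longrightarrow> m \<in> C \<Longrightarrow> hip M m (S u) = hip M (T m) u" by metis
  show "ualpha M J T \<in> adjointable (MsubJ_mod M J)"
    unfolding adjointable_def
  proof (intro CollectI conjI exI[of _ S] ballI; simp)
    fix k l assume kl: "k \<in> MsubJ M J" "l \<in> MsubJ M J"
    then have "k \<in> C" "l \<in> C" "S k \<in> C" "T l \<in> C" using S BJ_closed[OF T] by (auto simp: MsubJ_iff)
    then show "hip M (S k) l = hip M k (ualpha M J T l)"
      using S(2)[OF kl(1) \<open>l \<in> C\<close>] kl hip_cstar by (metis ualpha_def)
  qed (use S BJ_MsubJ[OF T] in \<open>auto simp: ualpha_def\<close>)
  show "opnorm (MsubJ_mod M J) (ualpha M J T) = opnorm M T"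
  proof (rule opnorm_cong, unfold MsubJ_mod_simps, intro iffI ballI impI)
    fix K m assume K: "\<forall>m\<in>MsubJ M J. hnorm M m \<le> 1 \<longrightarrow> hnorm M (ualpha M J T m) \<le> K"
      and m: "m \<in> C" "hnorm M m \<le> 1"
    \<comment> \<open>Test on x in the unit ball of \<open>J\<close>: T(m)x = T(mx), and mx is in
      the unit ball of \<open>M\<^sub>J\<close>.\<close>
    show "hnorm M (T m) \<le> K"
    proof (rule hnorm_le_by_compression[OF BJ_closed[OF T m(1)]])
      fix x assume x: "x \<in> J" "norm x \<le> 1"
      have "hnorm M (hact M m x) \<le> 1"
        using hnorm_act_le[OF m(1), of x] mult_mono[OF m(2) x(2)] by simp
      then have "hnorm M (ualpha M J T (hact M m x)) \<le> K" using K act_MsubJ[OF m(1) x(1)] by blast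
      then show "hnorm M (hact M (T m) x) \<le> K"
        using act_MsubJ[OF m(1) x(1)] BJ_act[OF T m(1)] by (simp add: ualpha_def)
    qed
  qed (auto simp: ualpha_def MsubJ_iff)
next
  fix S T assume S: "S \<in> BJ M J" and T: "T \<in> BJ M J"
  show "eq_on_carrier (MsubJ_mod M J) (ualpha M J (op_add M S T))
      (op_add (MsubJ_mod M J) (ualpha M J S) (ualpha M J T))"
    by (simp add: eq_on_carrier_def ualpha_def op_add_def)
  show "eq_on_carrier (MsubJ_mod M J) (ualpha M J (S \<circ> T)) (ualpha M J S \<circ> ualpha M J T)"
    using BJ_MsubJ[OF T] by (simp add: eq_on_carrier_def ualpha_def)
  assume eq: "eq_on_carrier (MsubJ_mod M J) (ualpha M J S) (ualpha M J T)"
  show "eq_on_carrier M S T"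
    unfolding eq_on_carrier_def
  proof
    fix m assume m: "m \<in> C"
    note c = BJ_closed[OF S m] BJ_closed[OF T m]
    have "hact M (S m) x = hact M (T m) x" if x: "x \<in> J" for x
    proof -
      have "S (hact M m x) = T (hact M m x)"
        using eq act_MsubJ[OF m x] by (simp add: eq_on_carrier_def ualpha_def)
      then show ?thesis using BJ_act[OF S m, of x] BJ_act[OF T m, of x] by simp
    qed
    then have "hip M k (S m) * x = hip M k (T m) * x" if "x \<in> J" "k \<in> C" for x k
      using that c hip_act by metis
    then have "hip M k (S m) = hip M k (T m)" if "k \<in> C" for k using essential_eq that by blast
    then show "S m = T m" by (rule hip_eqI[OF c])
  qed
qed (simp add: eq_on_carrier_def ualpha_def op_scale_def)

subsection \<open>The module \<open>M\<^sup>J\<close>\<close>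

lemma MupJ_M1: "f \<in> MupJ M J \<Longrightarrow> f \<in> M1 M J" by (simp add: MupJ_def)

lemma M1_outside: "f \<in> M1 M J \<Longrightarrow> m \<notin> C \<Longrightarrow> f m = 0"
  and M1_add: "f \<in> M1 M J \<Longrightarrow> m \<in> C \<Longrightarrow> n \<in> C \<Longrightarrow> f (hadd M m n) = f m + f n"
  and M1_act: "f \<in> M1 M J \<Longrightarrow> m \<in> C \<Longrightarrow> f (hact M m a) = cstar a * f m"
  by (simp_all add: M1_def Mprime_def)

lemma M1_bound: "f \<in> M1 M J \<Longrightarrow> \<exists>K. \<forall>m\<in>C. norm (f m) \<le> K * hnorm M m"
  by (simp add: M1_def Mprime_def)

text \<open>\<open>Mprime\<close> has no rule for complex scalars, so the difference is recovered
  from additivity and m = (m - n) + n.\<close>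

lemma M1_sub:
  assumes f: "f \<in> M1 M J" and m: "m \<in> C" and n: "n \<in> C"
  shows "f (hsub m n) = f m - f n"
proof -
  have "m = hadd M (hsub m n) n"
    by (rule hip_eqI) (simp_all add: m n add_closed sub_closed hip_add hip_sub)
  then have "f m = f (hsub m n) + f n" using M1_add[OF f sub_closed[OF m n] n] by simp
  then show ?thesis by simp
qed

lemma
  assumes f: "f \<in> M1 M J" and x: "x \<in> J"
  shows elem_fact_closed: "elem M (fact f x) \<in> C"
    and mhat_elem_fact: "mhat M (elem M (fact f x)) = fact f x"
    and hip_elem_fact: "m \<in> C \<Longrightarrow> hip M m (elem M (fact f x)) = f m * x"
    and elem_fact_MsubJ: "elem M (fact f x) \<in> MsubJ M J"
proof -
  have "fact f x \<in> mhat M ` C" using f x by (simp add: M1_def)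
  then show c: "elem M (fact f x) \<in> C" and h: "mhat M (elem M (fact f x)) = fact f x"
    using mhat_elem by auto
  have e: "hip M m (elem M (fact f x)) = f m * x" if "m \<in> C" for m
    using fun_cong[OF h, of m] that by (simp add: mhat_def fact_def)
  then show "m \<in> C \<Longrightarrow> hip M m (elem M (fact f x)) = f m * x" .
  show "elem M (fact f x) \<in> MsubJ M J" using c e x by (simp add: MsubJ_iff' J_mult)
qed

lemma fact_mhat: "n \<in> C \<Longrightarrow> fact (mhat M n) a = mhat M (hact M n a)"
  by (auto simp: fact_def mhat_def hip_act)

lemma elem_fact_mhat: "n \<in> C \<Longrightarrow> elem M (fact (mhat M n) a) = hact M n a"
  by (simp add: fact_mhat elem_mhat act_closed)

lemma mhat_M1: "n \<in> C \<Longrightarrow> mhat M n \<in> M1 M J"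
proof -
  assume n: "n \<in> C"
  have "\<forall>m\<in>C. norm (mhat M n m) \<le> hnorm M n * hnorm M m"
    using cauchy_schwarz n by (simp add: mhat_def mult.commute)
  then show ?thesis unfolding M1_def Mprime_def
    using n by (auto simp: mhat_def hip_add_left hip_act_left add_closed act_closed fact_mhat[unfolded mhat_def])
qed

lemma fact_M1:
  assumes f: "f \<in> M1 M J"
  shows "fact f a \<in> M1 M J"
proof -
  obtain K where K: "\<And>m. m \<in> C \<Longrightarrow> norm (f m) \<le> K * hnorm M m" using M1_bound[OF f] by blast
  have "norm (fact f a m) \<le> (K * norm a) * hnorm M m" if "m \<in> C" for m
    using norm_mult_ineq[of "f m" a] mult_right_mono[OF K[OF that] norm_ge_zero[of a]]
    by (simp add: fact_def algebra_simps)
  then have bound: "\<exists>K. \<forall>m\<in>C. norm (fact f a m) \<le> K * hnorm M m" by blast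
  have "fact f a \<in> Mprime M"
    unfolding Mprime_def by (intro CollectI conjI bound)
      (use f in \<open>auto simp: M1_def Mprime_def fact_def distrib_right mult.assoc\<close>)
  moreover have "fact (fact f a) x \<in> mhat M ` C" if "x \<in> J" for x
  proof -
    have "fact (fact f a) x = fact f (a * x)" by (simp add: fact_def fun_eq_iff mult.assoc)
    then show ?thesis using f J_mult(1)[OF that] by (simp add: M1_def)
  qed
  ultimately show ?thesis by (simp add: M1_def)
qed

text \<open>Essentiality makes \<open>A\<close> act faithfully on \<open>J\<close>, so the
  description in \<open>mjip\<close> picks a well-determined element.\<close>

lemma is_mult_ip_unique: "is_mult_ip M J g f a \<Longrightarrow> is_mult_ip M J g f b \<Longrightarrow> a = b"
  by (rule essential_eq) (simp add: is_mult_ip_def)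

lemma mjip_eqI: "is_mult_ip M J g f a \<Longrightarrow> mjip M J g f = a"
  unfolding mjip_def using is_mult_ip_unique by blast

lemma is_mult_ip_mjip: "f \<in> MupJ M J \<Longrightarrow> g \<in> M1 M J \<Longrightarrow> is_mult_ip M J g f (mjip M J g f)"
  using mjip_eqI unfolding MupJ_def by blast

text \<open>The involution exchanges the two halves of a double multiplier and replaces x by
  \<open>cstar x\<close>, which is again in \<open>J\<close>.\<close>

lemma is_mult_ip_cstar:
  assumes "is_mult_ip M J g f a"
  shows "is_mult_ip M J f g (cstar a)"
  unfolding is_mult_ip_def
proof (intro ballI conjI)
  fix x assume x: "x \<in> J"
  have "a * cstar x = cstar (g (elem M (fact f (cstar x))))" "cstar x * a = f (elem M (fact g x))"
    using assms J_cstar[OF x] by (simp_all add: is_mult_ip_def cs_cstar_cstar)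
  then have "cstar (a * cstar x) = g (elem M (fact f (cstar x)))" "cstar (cstar x * a) = cstar (f (elem M (fact g x)))"
    by (simp_all add: cs_cstar_cstar)
  then show "cstar a * x = cstar (f (elem M (fact g x)))" "x * cstar a = g (elem M (fact f (cstar x)))"
    by (simp_all add: cs_cstar_mult cs_cstar_cstar)
qed

lemma is_mult_ip_act:
  assumes "is_mult_ip M J g f c"
  shows "is_mult_ip M J g (fact f a) (c * a)"
  unfolding is_mult_ip_def
proof (intro ballI conjI)
  fix x assume x: "x \<in> J"
  have "fact (fact f a) x = fact f (a * x)" by (simp add: fact_def fun_eq_iff mult.assoc)
  then show "c * a * x = cstar (g (elem M (fact (fact f a) x)))"
    using assms J_mult(1)[OF x, of a] by (simp add: is_mult_ip_def mult.assoc)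
  have "x * c = f (elem M (fact g (cstar x)))" using assms x by (simp add: is_mult_ip_def)
  then show "x * (c * a) = fact f a (elem M (fact g (cstar x)))"
    by (simp add: fact_def mult.assoc[symmetric])
qed

text \<open>Pairing with an element of M is evaluation up to the involution and stays in
  \<open>A\<close>; hence M embeds into \<open>M\<^sup>J\<close>.\<close>

lemma is_mult_ip_mhat:
  assumes g: "g \<in> M1 M J" and n: "n \<in> C"
  shows "is_mult_ip M J g (mhat M n) (cstar (g n))"
  unfolding is_mult_ip_def
proof (intro ballI conjI)
  fix x assume x: "x \<in> J"
  note sx = J_cstar[OF x]
  show "cstar (g n) * x = cstar (g (elem M (fact (mhat M n) x)))"
    using n g by (simp add: elem_fact_mhat M1_act cs_cstar_mult cs_cstar_cstar)
  have "mhat M n (elem M (fact g (cstar x))) = cstar (hip M n (elem M (fact g (cstar x))))"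
    using elem_fact_closed[OF g sx] n by (simp add: mhat_def hip_cstar)
  also have "\<dots> = x * cstar (g n)" by (simp add: hip_elem_fact[OF g sx n] cs_cstar_mult cs_cstar_cstar)
  finally show "x * cstar (g n) = mhat M n (elem M (fact g (cstar x)))" by simp
qed

lemma mhat_MupJ: "n \<in> C \<Longrightarrow> mhat M n \<in> MupJ M J"
  using is_mult_ip_mhat mhat_M1 by (auto simp: MupJ_def)

lemma fact_MupJ: "f \<in> MupJ M J \<Longrightarrow> fact f a \<in> MupJ M J"
  using is_mult_ip_act fact_M1 unfolding MupJ_def by blast

lemma mjip_mhat: "g \<in> M1 M J \<Longrightarrow> n \<in> C \<Longrightarrow> mjip M J g (mhat M n) = cstar (g n)"
  by (rule mjip_eqI[OF is_mult_ip_mhat])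

lemma mjip_mhat_left: "f \<in> M1 M J \<Longrightarrow> n \<in> C \<Longrightarrow> mjip M J (mhat M n) f = f n"
  using mjip_eqI[OF is_mult_ip_cstar[OF is_mult_ip_mhat]] by (simp add: cs_cstar_cstar)

lemma mjip_cstar: "f \<in> MupJ M J \<Longrightarrow> g \<in> M1 M J \<Longrightarrow> cstar (mjip M J g f) = mjip M J f g"
  using mjip_eqI[OF is_mult_ip_cstar[OF is_mult_ip_mjip]] by simp

lemma mjip_act: "f \<in> MupJ M J \<Longrightarrow> g \<in> M1 M J \<Longrightarrow> mjip M J g (fact f a) = mjip M J g f * a"
  by (rule mjip_eqI[OF is_mult_ip_act[OF is_mult_ip_mjip]])

text \<open>For x in \<open>J\<close> the compression of <f,f> by x is <fx,fx>, an inner product in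
  M and so positive. Testing on \<open>J\<close> makes <f,f> positive, and its factor
  \<open>b\<close> carries the norms of f and of fx.\<close>

lemma MupJ_form:
  assumes f: "f \<in> MupJ M J"
  obtains b where "mjip M J f f = cstar b * b" "hnorm (MupJ_mod M J) f = norm b"
    "\<And>x. x \<in> J \<Longrightarrow> hnorm M (elem M (fact f x)) = norm (b * x)"
proof -
  note f1 = MupJ_M1[OF f]
  have comp: "cstar x * mjip M J f f * x = hip M (elem M (fact f x)) (elem M (fact f x))" if x: "x \<in> J" for x
  proof -
    let ?n = "elem M (fact f x)"
    have "mjip M J f f * x = cstar (f ?n)" using is_mult_ip_mjip[OF f f1] x by (simp add: is_mult_ip_def)
    then have "cstar x * mjip M J f f * x = cstar (f ?n * x)" by (simp add: cs_cstar_mult mult.assoc)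
    also have "\<dots> = cstar (hip M ?n ?n)" by (simp add: hip_elem_fact[OF f1 x elem_fact_closed[OF f1 x]])
    finally show ?thesis by (simp add: hip_cstar elem_fact_closed[OF f1 x])
  qed
  have "cs_positive (mjip M J f f)"
  proof (rule cs_positive_by_compression[OF ideal essential mjip_cstar[OF f f1]])
    show "cs_positive (cstar x * mjip M J f f * x)" if "x \<in> J" for x
      unfolding comp[OF that] by (intro hip_positive elem_fact_closed f1 that)
  qed
  then obtain b where b: "mjip M J f f = cstar b * b" by (auto simp: cs_positive_def)
  have "hnorm (MupJ_mod M J) f = norm b" by (simp add: hnorm_def MupJ_mod_def b cs_cstar_identity)
  moreover have "hnorm M (elem M (fact f x)) = norm (b * x)" if "x \<in> J" for x
  proof -
    have "hip M (elem M (fact f x)) (elem M (fact f x)) = cstar (b * x) * (b * x)"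
      by (simp add: comp[OF that, symmetric] b cs_cstar_mult mult.assoc)
    then show ?thesis by (simp add: hnorm_def cs_cstar_identity)
  qed
  ultimately show ?thesis using that b by blast
qed

text \<open>The elements f e_k of M form a Cauchy sequence because b e_k tends to b, and their limit
  represents f.\<close>

lemma MupJ_representable:
  assumes f: "f \<in> MupJ M J" and J: "mjip M J f f \<in> J"
  shows "f \<in> mhat M ` C"
proof -
  note f1 = MupJ_M1[OF f]
  obtain b where b: "mjip M J f f = cstar b * b"
    "\<And>x. x \<in> J \<Longrightarrow> hnorm M (elem M (fact f x)) = norm (b * x)" using MupJ_form[OF f] by metis
  obtain e where e: "\<And>k. e k \<in> J" "(\<lambda>k. b * e k) \<longlonglongrightarrow> b"
    using ideal_approximate_unit[OF ideal, of b] J b(1) by metis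
  define n where "n k = elem M (fact f (e k))" for k
  have n: "n k \<in> C" "\<And>m. m \<in> C \<Longrightarrow> hip M m (n k) = f m * e k" for k
    by (simp_all add: n_def elem_fact_closed[OF f1 e(1)] hip_elem_fact[OF f1 e(1)])
  have lim: "(\<lambda>k. f m * e k) \<longlonglongrightarrow> f m" if m: "m \<in> C" for m
  proof -
    \<comment> \<open>Cauchy-Schwarz is available in M only, so the estimate is made after
      multiplication by x in \<open>J\<close>, where f(x - e_k x) belongs to M, and then lifted by
      compression.\<close>
    have le: "norm (f m - f m * e k) \<le> hnorm M m * norm (b - b * e k)" for k
    proof (rule norm_le_by_compression[OF ideal essential])
      fix x assume x: "x \<in> J" "norm x \<le> 1"
      have xJ: "x - e k * x \<in> J" by (intro J_diff J_mult x)
      have "(f m - f m * e k) * x = hip M m (elem M (fact f (x - e k * x)))"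
        unfolding hip_elem_fact[OF f1 xJ m] by (simp add: algebra_simps)
      then have "norm ((f m - f m * e k) * x) \<le> hnorm M m * norm (b * (x - e k * x))"
        using cauchy_schwarz[OF m elem_fact_closed[OF f1 xJ]] b(2)[OF xJ] by simp
      also have "b * (x - e k * x) = (b - b * e k) * x" by (simp add: algebra_simps)
      also have "hnorm M m * norm ((b - b * e k) * x) \<le> hnorm M m * (norm (b - b * e k) * 1)"
        by (intro mult_left_mono hnorm_nonneg order_trans[OF norm_mult_ineq] x) simp
      finally show "norm ((f m - f m * e k) * x) \<le> hnorm M m * norm (b - b * e k)" by simp
    qed
    have b0: "(\<lambda>k. hnorm M m * norm (b - b * e k)) \<longlonglongrightarrow> 0"
      using tendsto_norm_zero[OF tendsto_diff[OF tendsto_const[of b] e(2), simplified]]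
      by (intro tendsto_mult_right_zero)
    have "(\<lambda>k. f m - f m * e k) \<longlonglongrightarrow> 0"
      by (rule Lim_null_comparison[OF always_eventually b0]) (simp add: le)
    from tendsto_diff[OF tendsto_const[of "f m"] this] show ?thesis by simp
  qed
  have dist: "hdist M (n k) (n l) \<le> 1 * norm (b * e k - b * e l)" for k l
  proof -
    have dJ: "e k - e l \<in> J" by (intro J_diff e)
    have "hsub (n k) (n l) = elem M (fact f (e k - e l))"
      by (rule hip_eqI) (simp_all add: n sub_closed elem_fact_closed[OF f1 dJ] hip_sub
          hip_elem_fact[OF f1 dJ] right_diff_distrib)
    then show ?thesis using b(2)[OF dJ] by (simp add: hdist_def right_diff_distrib)
  qed
  obtain l where l: "l \<in> C" "\<And>m. m \<in> C \<Longrightarrow> hip M m l = f m"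
    using functional_limit[OF n lim dist e(2)] by blast
  have "f m = mhat M l m" for m by (cases "m \<in> C") (simp_all add: mhat_def l M1_outside[OF f1])
  then have "f = mhat M l" by (rule ext)
  then show ?thesis using l(1) by blast
qed

text \<open>Since e_k is self-adjoint, g(m e_k) = e_k g(m); boundedness of g makes these elements of
  \<open>J\<close> converge to g(m).\<close>

lemma M1_MsubJ:
  assumes g: "g \<in> M1 M J" and m: "m \<in> MsubJ M J"
  shows "g m \<in> J"
proof -
  have mC: "m \<in> C" "hip M m m \<in> J" using m by (auto simp: MsubJ_iff)
  obtain e b where e: "\<And>k. e k \<in> J" "(\<lambda>k. b * e k) \<longlonglongrightarrow> b"
    "\<And>x. hdist M m (hact M m x) = norm (b - b * x)" "\<And>k. cstar (e k) = e k"
    using MsubJ_approx[OF mC] by metis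
  obtain K where K: "\<And>m. m \<in> C \<Longrightarrow> norm (g m) \<le> K * hnorm M m" using M1_bound[OF g] by blast
  have b0: "(\<lambda>k. K * norm (b - b * e k)) \<longlonglongrightarrow> 0"
    using tendsto_norm_zero[OF tendsto_diff[OF tendsto_const[of b] e(2), simplified]]
    by (intro tendsto_mult_right_zero)
  have "(\<lambda>k. g m - e k * g m) \<longlonglongrightarrow> 0"
  proof (rule Lim_null_comparison[OF always_eventually b0], rule allI)
    fix k
    have "g m - e k * g m = g (hsub m (hact M m (e k)))"
      using mC by (simp add: M1_sub[OF g] M1_act[OF g] act_closed e(4))
    then show "norm (g m - e k * g m) \<le> K * norm (b - b * e k)"
      using K[OF sub_closed[OF mC(1) act_closed[OF mC(1), of "e k"]]] e(3)[of "e k"] by (simp add: hdist_def)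
  qed
  from tendsto_diff[OF tendsto_const[of "g m"] this] have "(\<lambda>k. e k * g m) \<longlonglongrightarrow> g m" by simp
  then show ?thesis by (rule J_limit[rotated]) (intro J_mult e)
qed

lemma hnorm_mhat: "n \<in> C \<Longrightarrow> hnorm (MupJ_mod M J) (mhat M n) = hnorm M n"
  by (simp add: hnorm_def MupJ_mod_def mjip_mhat_left mhat_M1 mhat_apply)

section \<open>Restriction of adjointable operators on \<open>M\<^sup>J\<close>\<close>

lemma alpha_apply: "m \<in> MsubJ M J \<Longrightarrow> alpha M J R m = elem M (R (mhat M m))"
  by (simp add: alpha_def)

text \<open>Naming the adjoint makes the situation symmetric, so that results about \<open>R\<close>
  transfer to \<open>Rs\<close>.\<close>

definition adjoint_pair :: "(('m \<Rightarrow> 'a) \<Rightarrow> 'm \<Rightarrow> 'a) \<Rightarrow> (('m \<Rightarrow> 'a) \<Rightarrow> 'm \<Rightarrow> 'a) \<Rightarrow> bool" where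
  "adjoint_pair R Rs \<longleftrightarrow> (\<forall>f\<in>MupJ M J. R f \<in> MupJ M J) \<and> (\<forall>f\<in>MupJ M J. Rs f \<in> MupJ M J) \<and>
    (\<forall>f\<in>MupJ M J. \<forall>g\<in>MupJ M J. mjip M J (Rs f) g = mjip M J f (R g))"

lemma adjointable_iff: "R \<in> adjointable (MupJ_mod M J) \<longleftrightarrow> (\<exists>Rs. adjoint_pair R Rs)"
  by (auto simp: adjointable_def MupJ_mod_def adjoint_pair_def)

lemma adjoint_pair_sym:
  assumes "adjoint_pair R Rs"
  shows "adjoint_pair Rs R"
proof -
  have "mjip M J (R f) g = mjip M J f (Rs g)" if f: "f \<in> MupJ M J" and g: "g \<in> MupJ M J" for f g
  proof -
    have "R f \<in> MupJ M J" "Rs g \<in> MupJ M J" "mjip M J (Rs g) f = mjip M J g (R f)"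
      using assms f g by (auto simp: adjoint_pair_def)
    then show ?thesis using mjip_cstar[of "R f" g] mjip_cstar[of f "Rs g"] f g MupJ_M1 by metis
  qed
  then show ?thesis using assms by (simp add: adjoint_pair_def)
qed

context
  fixes R Rs
  assumes RRs: "adjoint_pair R Rs"
begin

lemma adjoint_pair_closed: "f \<in> MupJ M J \<Longrightarrow> R f \<in> MupJ M J" and adjoint_pair_closed': "f \<in> MupJ M J \<Longrightarrow> Rs f \<in> MupJ M J"
  and adjoint_pair_eq: "f \<in> MupJ M J \<Longrightarrow> g \<in> MupJ M J \<Longrightarrow> mjip M J (Rs f) g = mjip M J f (R g)"
  using RRs by (simp_all add: adjoint_pair_def)

text \<open>Module linearity is forced by the adjoint: evaluation at m is the pairing with
  \<open>mhat M m\<close>, and \<open>R\<close> moves to the other side of it.\<close>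

lemma adjointable_act:
  assumes f: "f \<in> MupJ M J"
  shows "R (fact f a) = fact (R f) a"
proof
  fix m
  note fa = fact_MupJ[OF f, of a]
  show "R (fact f a) m = fact (R f) a m"
  proof (cases "m \<in> C")
    case True
    note mm = mhat_MupJ[OF True]
    have "R (fact f a) m = mjip M J (Rs (mhat M m)) (fact f a)"
      using adjoint_pair_eq[OF mm fa] mjip_mhat_left[OF MupJ_M1[OF adjoint_pair_closed[OF fa]] True] by simp
    also have "\<dots> = mjip M J (Rs (mhat M m)) f * a" by (rule mjip_act[OF f MupJ_M1[OF adjoint_pair_closed'[OF mm]]])
    also have "\<dots> = R f m * a" using adjoint_pair_eq[OF mm f] mjip_mhat_left[OF MupJ_M1[OF adjoint_pair_closed[OF f]] True] by simp
    finally show ?thesis by (simp add: fact_def)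
  next
    case False
    then show ?thesis
      using M1_outside[OF MupJ_M1[OF adjoint_pair_closed[OF fa]] False] M1_outside[OF MupJ_M1[OF adjoint_pair_closed[OF f]] False]
      by (simp add: fact_def)
  qed
qed

lemma
  assumes m: "m \<in> MsubJ M J"
  shows alpha_MsubJ: "alpha M J R m \<in> MsubJ M J"
    and mhat_alpha: "mhat M (alpha M J R m) = R (mhat M m)"
proof -
  have mC: "m \<in> C" using m by (simp add: MsubJ_iff)
  define f where "f = R (mhat M m)"
  have f: "f \<in> MupJ M J" unfolding f_def by (intro adjoint_pair_closed mhat_MupJ mC)
  \<comment> \<open>Moving \<open>R\<close> across turns <f,f> into a value of \<open>Rs f\<close>
    at a point of \<open>M\<^sub>J\<close>, up to the involution, so it lies in \<open>J\<close>.
    Hence f comes from M, and \<open>elem\<close> returns a genuine preimage.\<close>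
  have "mjip M J f f = mjip M J (Rs f) (mhat M m)" using adjoint_pair_eq[OF f mhat_MupJ[OF mC]] by (simp add: f_def)
  also have "\<dots> = cstar (Rs f m)" by (rule mjip_mhat[OF MupJ_M1[OF adjoint_pair_closed'[OF f]] mC])
  also have "\<dots> \<in> J" by (intro J_cstar M1_MsubJ[OF MupJ_M1[OF adjoint_pair_closed'[OF f]] m])
  finally have fJ: "mjip M J f f \<in> J" .
  have e: "elem M f \<in> C" "mhat M (elem M f) = f" using mhat_elem[OF MupJ_representable[OF f fJ]] by auto
  then have "hip M (elem M f) (elem M f) = mjip M J f f"
    using mjip_mhat_left[OF MupJ_M1[OF f] e(1)] mhat_apply[OF e(1), of "elem M f"] by simp
  moreover have "alpha M J R m = elem M f" using m by (simp add: alpha_def f_def)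
  ultimately show "alpha M J R m \<in> MsubJ M J" "mhat M (alpha M J R m) = R (mhat M m)"
    using e fJ by (simp_all add: MsubJ_iff f_def)
qed

lemma alpha_opnorm: "opnorm (MsubJ_mod M J) (alpha M J R) = opnorm (MupJ_mod M J) R"
proof (rule opnorm_cong, unfold MsubJ_mod_simps, intro iffI ballI impI)
  fix K m assume K: "\<forall>f\<in>hcarrier (MupJ_mod M J). hnorm (MupJ_mod M J) f \<le> 1 \<longrightarrow> hnorm (MupJ_mod M J) (R f) \<le> K"
    and m: "m \<in> MsubJ M J" "hnorm M m \<le> 1"
  have mC: "m \<in> C" "alpha M J R m \<in> C" using m alpha_MsubJ by (auto simp: MsubJ_iff)
  have "mhat M m \<in> hcarrier (MupJ_mod M J)" using mhat_MupJ[OF mC(1)] by (simp add: MupJ_mod_def)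
  then have "hnorm (MupJ_mod M J) (R (mhat M m)) \<le> K" using K m(2) hnorm_mhat[OF mC(1)] by simp
  then show "hnorm M (alpha M J R m) \<le> K" using hnorm_mhat[OF mC(2)] by (simp add: mhat_alpha[OF m(1)])
next
  fix K f assume K: "\<forall>m\<in>MsubJ M J. hnorm M m \<le> 1 \<longrightarrow> hnorm M (alpha M J R m) \<le> K"
    and "f \<in> hcarrier (MupJ_mod M J)" and nf: "hnorm (MupJ_mod M J) f \<le> 1"
  then have f: "f \<in> MupJ M J" by (simp add: MupJ_mod_def)
  obtain b where b: "hnorm (MupJ_mod M J) (R f) = norm b"
    "\<And>x. x \<in> J \<Longrightarrow> hnorm M (elem M (fact (R f) x)) = norm (b * x)" using MupJ_form[OF adjoint_pair_closed[OF f]] by metis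
  obtain c where c: "hnorm (MupJ_mod M J) f = norm c"
    "\<And>x. x \<in> J \<Longrightarrow> hnorm M (elem M (fact f x)) = norm (c * x)" using MupJ_form[OF f] by metis
  \<comment> \<open>For x in the unit ball of \<open>J\<close>, fx is in the unit ball of
    \<open>M\<^sub>J\<close>, and \<open>alpha M J R\<close> sends it to (R f)x. Compression
    recovers the norm of R f.\<close>
  show "hnorm (MupJ_mod M J) (R f) \<le> K"
    unfolding b(1)
  proof (rule norm_le_by_compression[OF ideal essential])
    fix x assume x: "x \<in> J" "norm x \<le> 1"
    let ?n = "elem M (fact f x)"
    have nJ: "?n \<in> MsubJ M J" by (rule elem_fact_MsubJ[OF MupJ_M1[OF f] x(1)])
    have "alpha M J R ?n = elem M (fact (R f) x)"
      using nJ by (simp add: alpha_def mhat_elem_fact[OF MupJ_M1[OF f] x(1)] adjointable_act[OF f])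
    moreover have "norm (c * x) \<le> 1"
      using norm_mult_ineq[of c x] mult_mono[of "norm c" 1 "norm x" 1] x nf c(1) by simp
    then have "hnorm M ?n \<le> 1" by (simp add: c(2)[OF x(1)])
    ultimately show "norm (b * x) \<le> K" using K nJ b(2)[OF x(1)] by metis
  qed
qed

end

text \<open>The restriction of \<open>Rs\<close> serves as adjoint, since \<open>mhat\<close>
  preserves inner products.\<close>

lemma alpha_adjointable:
  assumes R: "R \<in> adjointable (MupJ_mod M J)"
  shows "alpha M J R \<in> adjointable (MsubJ_mod M J)"
proof -
  obtain Rs where r: "adjoint_pair R Rs" using R adjointable_iff by blast
  note a = alpha_MsubJ[OF r] mhat_alpha[OF r] alpha_MsubJ[OF adjoint_pair_sym[OF r]]
    mhat_alpha[OF adjoint_pair_sym[OF r]]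
  show ?thesis
    unfolding adjointable_def
  proof (intro CollectI conjI exI[of _ "alpha M J Rs"] ballI; simp)
    fix k l assume kl: "k \<in> MsubJ M J" "l \<in> MsubJ M J"
    then have C: "k \<in> C" "l \<in> C" "alpha M J R l \<in> C" "alpha M J Rs k \<in> C" using a by (auto simp: MsubJ_iff)
    have "hip M (alpha M J Rs k) l = mjip M J (Rs (mhat M k)) (mhat M l)"
      using mjip_mhat_left[OF mhat_M1[OF C(2)] C(4)] a(4)[OF kl(1)] C by (simp add: mhat_apply)
    also have "\<dots> = mjip M J (mhat M k) (R (mhat M l))" by (intro adjoint_pair_eq[OF r] mhat_MupJ C)
    also have "\<dots> = hip M k (alpha M J R l)"
      using mjip_mhat_left[OF mhat_M1[OF C(3)] C(1)] mhat_apply[OF C(1), of "alpha M J R l"]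
      by (simp add: a(2)[OF kl(2)])
    finally show "hip M (alpha M J Rs k) l = hip M k (alpha M J R l)" .
  qed (use a in auto)
qed

lemma alpha_isometric:
  "isometric_injective_hom (MupJ_mod M J) (MsubJ_mod M J) (adjointable (MupJ_mod M J)) (alpha M J)"
  unfolding isometric_injective_hom_def
proof (intro conjI ballI allI impI)
  fix R assume "R \<in> adjointable (MupJ_mod M J)"
  then show "alpha M J R \<in> adjointable (MsubJ_mod M J)" by (rule alpha_adjointable)
next
  fix R assume "R \<in> adjointable (MupJ_mod M J)"
  then obtain Rs where r: "adjoint_pair R Rs" using adjointable_iff by blast
  show "opnorm (MsubJ_mod M J) (alpha M J R) = opnorm (MupJ_mod M J) R" by (rule alpha_opnorm[OF r])
  fix c
  show "eq_on_carrier (MsubJ_mod M J) (alpha M J (op_scale (MupJ_mod M J) c R))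
      (op_scale (MsubJ_mod M J) c (alpha M J R))"
    unfolding eq_on_carrier_def MsubJ_mod_simps
  proof
    fix m assume m: "m \<in> MsubJ M J"
    have n: "alpha M J R m \<in> C" using alpha_MsubJ[OF r m] by (simp add: MsubJ_iff)
    \<comment> \<open>The value at \<open>mhat M m\<close> is exhibited as an image under
      \<open>mhat\<close>, so that \<open>elem\<close> can be evaluated.\<close>
    have e: "op_scale (MupJ_mod M J) c R (mhat M m) = mhat M (hscale M c (alpha M J R m))"
      using n unfolding op_scale_def mhat_alpha[OF r m, symmetric]
      by (auto simp: MupJ_mod_def mhat_def hip_scale)
    have "alpha M J (op_scale (MupJ_mod M J) c R) m = hscale M c (alpha M J R m)"
      unfolding alpha_apply[OF m, of "op_scale (MupJ_mod M J) c R"] e by (rule elem_mhat[OF scale_closed[OF n]])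
    then show "alpha M J (op_scale (MupJ_mod M J) c R) m = op_scale (MsubJ_mod M J) c (alpha M J R) m"
      by (simp add: op_scale_def[of "MsubJ_mod M J"])
  qed
next
  fix R S assume "R \<in> adjointable (MupJ_mod M J)" "S \<in> adjointable (MupJ_mod M J)"
  then obtain Rs Ss where r: "adjoint_pair R Rs" and s: "adjoint_pair S Ss"
    using adjointable_iff by blast
  show "eq_on_carrier (MsubJ_mod M J) (alpha M J (op_add (MupJ_mod M J) R S))
      (op_add (MsubJ_mod M J) (alpha M J R) (alpha M J S))"
    unfolding eq_on_carrier_def MsubJ_mod_simps
  proof
    fix m assume m: "m \<in> MsubJ M J"
    have n: "alpha M J R m \<in> C" "alpha M J S m \<in> C"
      using alpha_MsubJ[OF r m] alpha_MsubJ[OF s m] by (simp_all add: MsubJ_iff)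
    have e: "op_add (MupJ_mod M J) R S (mhat M m) = mhat M (hadd M (alpha M J R m) (alpha M J S m))"
      using n unfolding op_add_def mhat_alpha[OF r m, symmetric] mhat_alpha[OF s m, symmetric]
      by (auto simp: MupJ_mod_def mhat_def hip_add)
    have "alpha M J (op_add (MupJ_mod M J) R S) m = hadd M (alpha M J R m) (alpha M J S m)"
      unfolding alpha_apply[OF m, of "op_add (MupJ_mod M J) R S"] e by (rule elem_mhat[OF add_closed[OF n]])
    then show "alpha M J (op_add (MupJ_mod M J) R S) m = op_add (MsubJ_mod M J) (alpha M J R) (alpha M J S) m"
      by (simp add: op_add_def[of "MsubJ_mod M J"])
  qed
  show "eq_on_carrier (MsubJ_mod M J) (alpha M J (R \<circ> S)) (alpha M J R \<circ> alpha M J S)"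
    unfolding eq_on_carrier_def MsubJ_mod_simps
  proof
    fix m assume m: "m \<in> MsubJ M J"
    show "alpha M J (R \<circ> S) m = (alpha M J R \<circ> alpha M J S) m"
      by (simp add: alpha_apply[OF m, of "R \<circ> S"] alpha_apply[OF alpha_MsubJ[OF s m], of R] mhat_alpha[OF s m])
  qed
  assume eq: "eq_on_carrier (MsubJ_mod M J) (alpha M J R) (alpha M J S)"
  show "eq_on_carrier (MupJ_mod M J) R S"
    unfolding eq_on_carrier_def
  proof (intro ballI ext)
    fix f m assume "f \<in> hcarrier (MupJ_mod M J)"
    then have f: "f \<in> MupJ M J" by (simp add: MupJ_mod_def)
    show "R f m = S f m"
    \<comment> \<open>Multiplication by x in \<open>J\<close> moves f into \<open>M\<^sub>J\<close>,
      where R and S agree; essentiality removes x again.\<close>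
    proof (rule essential_eq)
      fix x assume x: "x \<in> J"
      let ?n = "elem M (fact f x)"
      have nJ: "?n \<in> MsubJ M J" by (rule elem_fact_MsubJ[OF MupJ_M1[OF f] x])
      have "R (mhat M ?n) = S (mhat M ?n)"
        using eq nJ mhat_alpha[OF r nJ] mhat_alpha[OF s nJ] by (simp add: eq_on_carrier_def)
      then have "fact (R f) x = fact (S f) x"
        unfolding mhat_elem_fact[OF MupJ_M1[OF f] x] adjointable_act[OF r f] adjointable_act[OF s f] .
      then show "R f m * x = S f m * x" by (metis fact_def)
    qed
  qed
qed

end

theorem theorem3p6:
  fixes M :: "('m, 'a::cstar_algebra) hmod" and J :: "'a set"
  assumes "hilbert_module M" and "cstar_ideal J" and "essential_ideal J"
  shows "isometric_injective_hom (MupJ_mod M J) (MsubJ_mod M J) (adjointable (MupJ_mod M J)) (alpha M J)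
       \<and> isometric_injective_hom M (MsubJ_mod M J) (BJ M J) (ualpha M J)"
proof -
  interpret hmod_essential M J using assms by unfold_locales
  show ?thesis using alpha_isometric ualpha_isometric ..
qed

end
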